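(* Let $n\ge2$ and $p\in\mathbb{N}$. For any $K\in\mathcal{K}(\mathbb{R}^n)$ with $0\in K$ and any $t\in[0,1]$, one has $$\left|-t\Delta_pK\vee(1-t)K^p\right|\leq(1-t)^{n(p-1)}|K|^p.$$ If $\dim(K)=n$ and equality holds for some $t\in(0,1)$, then $K$ is a simplex with a vertex at the origin.
   Context: $\mathcal{K}(\mathbb{R}^n)$ denotes the set of convex bodies, i.e. nonempty compact convex subsets of $\mathbb{R}^n$; $|\cdot|$ is Lebesgue measure (in the dimension of the ambient space); $\dim K$ is the dimension of the affine span of $K$; a simplex is the convex hull of affinely independent points (its vertices). $K_1\vee K_2=\mathrm{conv}(K_1\cup K_2)$. Identify $\mathbb{R}^{np}=(\mathbb{R}^n)^p$; $\Delta_p:\mathbb{R}^n\to\mathbb{R}^{np}$, $\Delta_p(x)=(x,\dots,x)$; $-t\Delta_pK=\{-t\Delta_p(x):x\in K\}$; $K^p=K\times\cdots\times K\subset\mathbb{R}^{np}$, and $(1-t)K^p$ is its dilate by $1-t$. Convention $0^0=1$. *)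

theory Defs
  imports "HOL-Analysis.Analysis"
begin

definition convex_body :: "'a::euclidean_space set \<Rightarrow> bool" where
  "convex_body K \<longleftrightarrow> K \<noteq> {} \<and> compact K \<and> convex K"

definition join :: "'a::real_vector set \<Rightarrow> 'a set \<Rightarrow> 'a set"  (infixl "\<squnion>\<^sub>c" 65) where
  "A \<squnion>\<^sub>c B = convex hull (A \<union> B)"

text \<open>
  The space of p-tuples of points of a Euclidean space \<open>E\<close> is the type \<open>E ^ 'p\<close> with
  \<open>p = CARD('p)\<close> (so \<open>p \<ge> 1\<close>); its Euclidean structure is the one of the p-fold orthogonal
  direct sum, hence \<open>lebesgue\<close> on \<open>real ^ 'n ^ 'p\<close> is the Lebesgue measure of dimension
  \<open>CARD('n) * CARD('p)\<close>.
\<close>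

definition diag :: "'a \<Rightarrow> 'a ^ 'p" where
  "diag x = (\<chi> i. x)"

definition cart_power :: "'a set \<Rightarrow> ('a ^ 'p) set" where
  "cart_power K = {x. \<forall>i. x $ i \<in> K}"

definition simplex_with_vertices :: "'a::euclidean_space set \<Rightarrow> 'a set \<Rightarrow> bool" where
  "simplex_with_vertices K V \<longleftrightarrow> \<not> affine_dependent V \<and> K = convex hull V"

end

(* The join is the projection of the compact convex set
   C = {(z, x, \<theta>). 0 \<le> \<theta> \<le> 1, x \<in> (1 - \<theta>) K, z + t \<Delta> x \<in> (1 - t) \<theta> K^p},
   whose volume Fubini's theorem computes with the variables in the other order.  Write F(z) for the
   fibre of C over z.  If z = s b with b in the projection, then by convexity F(z) contains a translate
   of (1 - s) F(0); integrating this over the projection bounds |F(0)| times the volume of the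
   projection by a constant multiple of |C|.  The Beta integrals on both sides are the same and cancel,
   which is the inequality.

   In the equality case the fibre over every interior point z is a translate of a multiple of F(0).
   For diagonal z near 0 this makes the gauge of K additive on the cone N generated by K, and it gives
   N enough of the lattice property for two distinct nonzero extreme points of K to be disjoint in the
   order of N.  Disjoint elements are linearly independent, so the extreme points of K are
   affinely independent, and 0 is one of them. *)

theory Submission
  imports Defs
begin

section \<open>Simplices with a vertex at the origin\<close>

text \<open>The pair (x, \<theta>) gives fibres of dimension n + 1, and this makes the Beta
  integrals match. In the lower bound for |C| the weight (1 - s)^(n + 1) is written as the integral
  of its derivative, which leaves (n + 1) (1 - r)^n; in the formula for |C| the same exponent n
  comes from the slices (1 - \<theta>) K. Both times the integrand is (1 - r)^n r^(np). The extra n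
  + 1 cancels because F(0) is a double cone of total height 1 over (1 - t) K, so (n + 1) |F(0)| = (1
  - t)^n |K|. Equality of the integrals controls the fibres only almost everywhere; lower
  semicontinuity of s and convexity extend this to each interior point. There a convex body contains
  a homothetic copy of the same volume and equals it. Over the diagonal point with all coordinates t
  y the fibre is the intersection of two opposed cones with apexes (0, 1) and (- y, 0). Following
  the two tips of F(0) under the homothety turns geometry into order: the upper tip records a gauge,
  the lower one acts as a supremum of 0 and - y.\<close>

lemma scaled_sum_mem:
  fixes K :: "'a::real_vector set"
  assumes "convex K" "0 \<le> a" "0 \<le> b" "x \<in> (*\<^sub>R) a ` K" "y \<in> (*\<^sub>R) b ` K"
  shows "x + y \<in> (*\<^sub>R) (a + b) ` K"
proof (cases "a + b = 0")
  case True
  then show ?thesis using assms by (auto simp: add_nonneg_eq_0_iff)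
next
  case False
  obtain k l where k: "k \<in> K" "x = a *\<^sub>R k" and l: "l \<in> K" "y = b *\<^sub>R l"
    using assms by auto
  have "(a / (a + b)) *\<^sub>R k + (b / (a + b)) *\<^sub>R l \<in> K"
    using False assms k l by (intro convexD) (auto simp: add_divide_distrib[symmetric])
  moreover have "x + y = (a + b) *\<^sub>R ((a / (a + b)) *\<^sub>R k + (b / (a + b)) *\<^sub>R l)"
    using False by (simp add: scaleR_right_distrib k l)
  ultimately show ?thesis by blast
qed

lemma scaled_mono:
  fixes K :: "'a::real_vector set"
  assumes "convex K" "0 \<in> K" "0 \<le> a" "a \<le> b" "x \<in> (*\<^sub>R) a ` K"
  shows "x \<in> (*\<^sub>R) b ` K"
proof -
  have "0 \<in> (*\<^sub>R) (b - a) ` K" using assms(2) by (metis image_eqI scaleR_zero_right)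
  from scaled_sum_mem[OF assms(1,3) _ assms(5) this] assms(4) show ?thesis by simp
qed

lemma scaled_scaled: "x \<in> (*\<^sub>R) a ` K \<Longrightarrow> b *\<^sub>R x \<in> (*\<^sub>R) (b * a) ` (K::'a::real_vector set)"
  by auto

lemma scaled_scaled_iff:
  assumes "b \<noteq> 0"
  shows "b *\<^sub>R x \<in> (*\<^sub>R) (b * a) ` (K::'a::real_vector set) \<longleftrightarrow> x \<in> (*\<^sub>R) a ` K"
proof
  assume "b *\<^sub>R x \<in> (*\<^sub>R) (b * a) ` K"
  then obtain k where k: "k \<in> K" "b *\<^sub>R x = b *\<^sub>R (a *\<^sub>R k)" by auto
  then have "x = a *\<^sub>R k" using assms scaleR_left_imp_eq by blast
  then show "x \<in> (*\<^sub>R) a ` K" using k by blast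
qed (rule scaled_scaled)

text \<open>The cone N. Below, \<open>y - x \<in> gen_cone K\<close> is to be read as x \<le> y in
  the order of N.\<close>

definition gen_cone :: "'a::real_vector set \<Rightarrow> 'a set" where
  "gen_cone K = {x. \<exists>a\<ge>0. x \<in> (*\<^sub>R) a ` K}"

lemma gen_coneI: "0 \<le> a \<Longrightarrow> x \<in> (*\<^sub>R) a ` K \<Longrightarrow> x \<in> gen_cone K"
  by (auto simp: gen_cone_def)

lemma gen_cone_add: "convex K \<Longrightarrow> x \<in> gen_cone K \<Longrightarrow> y \<in> gen_cone K \<Longrightarrow> x + y \<in> gen_cone K"
  unfolding gen_cone_def mem_Collect_eq
  by (elim exE conjE) (rule exI, rule conjI[OF _ scaled_sum_mem], rule add_nonneg_nonneg)

lemma gen_cone_scale: "0 \<le> a \<Longrightarrow> x \<in> gen_cone K \<Longrightarrow> a *\<^sub>R x \<in> gen_cone K"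
  unfolding gen_cone_def mem_Collect_eq
  by (elim exE conjE) (rule exI, rule conjI[OF _ scaled_scaled], rule mult_nonneg_nonneg)

lemma gen_cone_scale_iff: "0 < a \<Longrightarrow> a *\<^sub>R x \<in> gen_cone K \<longleftrightarrow> x \<in> gen_cone K"
  using gen_cone_scale[of a x K] gen_cone_scale[of "inverse a" "a *\<^sub>R x" K] by auto

lemma gen_cone_subset: "K \<subseteq> gen_cone K"
  by (auto intro: gen_coneI[of 1])

text \<open>Stated as an eventuality at 0+, so that finitely many smallness demands can be met by
  one scaling factor \<open>h\<close>.\<close>

lemma eventually_gen_cone_scaled_mem:
  assumes "convex K" "0 \<in> K" "x \<in> gen_cone K" "0 < d"
  shows "eventually (\<lambda>e. e *\<^sub>R x \<in> (*\<^sub>R) d ` K) (at_right 0)"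
proof -
  obtain a where a: "a \<ge> 0" "x \<in> (*\<^sub>R) a ` K" using assms(3) by (auto simp: gen_cone_def)
  have "((\<lambda>e. e * a) \<longlongrightarrow> 0 * a) (at_right 0)" by (intro tendsto_intros)
  then have "eventually (\<lambda>e. e * a < d) (at_right 0)"
    using assms(4) by (intro order_tendstoD(2)) auto
  moreover have "eventually (\<lambda>e::real. 0 < e) (at_right 0)"
    by (simp add: eventually_at_right_less)
  ultimately show ?thesis
  proof eventually_elim
    case (elim e)
    then show ?case
      using scaled_mono[OF assms(1,2), of "e * a" d "e *\<^sub>R x"] scaled_scaled[OF a(2), of e] a(1) by simp
  qed
qed

text \<open>The second axiom is what is needed of the lattice property of the order whose positive cone is
  \<open>gen_cone K\<close>: the lower bounds \<open>0\<close> and \<open>v\<close> and the upper bounds \<open>u\<close> and \<open>w\<close> are interpolated by \<open>r\<close>.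
  The first axiom is superadditivity of the gauge of \<open>K\<close>.\<close>

locale split_body =
  fixes K :: "'a::euclidean_space set"
  assumes body: "convex_body K" and zero: "0 \<in> K"
    and split: "\<And>x y a. \<lbrakk>x \<in> gen_cone K; y \<in> gen_cone K; 0 \<le> a; x + y \<in> (*\<^sub>R) a ` K\<rbrakk>
      \<Longrightarrow> \<exists>l m. 0 \<le> l \<and> 0 \<le> m \<and> l + m \<le> a \<and> x \<in> (*\<^sub>R) l ` K \<and> y \<in> (*\<^sub>R) m ` K"
    and interp: "\<And>u w v. \<lbrakk>u \<in> gen_cone K; w \<in> gen_cone K; u - v \<in> gen_cone K; w - v \<in> gen_cone K\<rbrakk>
      \<Longrightarrow> \<exists>r. r \<in> gen_cone K \<and> u - r \<in> gen_cone K \<and> w - r \<in> gen_cone K \<and> r - v \<in> gen_cone K"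
begin

lemma cvx: "convex K" using body by (simp add: convex_body_def)

lemma zero_gen_cone: "0 \<in> gen_cone K" using zero gen_cone_subset by blast

text \<open>The splitting axiom at \<open>a = 0\<close> leaves only the factor 0 for each
  summand.\<close>

lemma pointed:
  assumes "x \<in> gen_cone K" "- x \<in> gen_cone K" shows "x = 0"
proof -
  have "x + - x \<in> (*\<^sub>R) 0 ` K" using zero by auto
  from split[OF assms order_refl this] obtain l m where "0 \<le> l" "0 \<le> m" "l + m \<le> 0" "x \<in> (*\<^sub>R) l ` K"
    by blast
  moreover from this have "l = 0" by simp
  ultimately show ?thesis by auto
qed

text \<open>The ends of an open segment through 0 lie on opposite rays of N, against
  pointedness.\<close>

lemma zero_extreme: "0 extreme_point_of K"
proof -
  { fix a b u assume *: "a \<in> K" "b \<in> K" "a \<noteq> b" "0 < u" "u < (1::real)" "0 = (1 - u) *\<^sub>R a + u *\<^sub>R b"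
    have 1: "(1 - u) *\<^sub>R a \<in> gen_cone K" "u *\<^sub>R b \<in> gen_cone K"
      using * gen_cone_subset[of K] gen_cone_scale[of "1 - u" a K] gen_cone_scale[of u b K] by auto
    have 2: "- ((1 - u) *\<^sub>R a) = u *\<^sub>R b" using *(6) by (metis add.commute neg_eq_iff_add_eq_0)
    then have "(1 - u) *\<^sub>R a = 0" using pointed 1 by metis
    then have False using * 2 by auto }
  then show ?thesis using zero unfolding extreme_point_of_def
    by (auto simp: in_segment)
qed

text \<open>Splitting \<open>v = x + (v - x)\<close> with total gauge 1 makes \<open>v\<close> a
  convex combination of points of \<open>K\<close> on the rays of \<open>x\<close> and
  \<open>v - x\<close>; extremality forces these points to coincide.\<close>

lemma extreme_ray:
  assumes v: "v extreme_point_of K" "v \<noteq> 0" and x: "x \<in> gen_cone K" "v - x \<in> gen_cone K"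
  shows "\<exists>a\<ge>0. x = a *\<^sub>R v"
proof -
  have vK: "v \<in> K" using v by (simp add: extreme_point_of_def)
  have "x + (v - x) \<in> (*\<^sub>R) 1 ` K" using vK by simp
  from split[OF x _ this] obtain l m where lm: "0 \<le> l" "0 \<le> m" "l + m \<le> 1"
    "x \<in> (*\<^sub>R) l ` K" "v - x \<in> (*\<^sub>R) m ` K" by auto
  then obtain k where k: "k \<in> K" "x = l *\<^sub>R k" by auto
  \<comment> \<open>Since \<open>0 \<in> K\<close>, the factor \<open>m\<close> may be enlarged to
    \<open>1 - l\<close>, and the two weights then add up to exactly 1.\<close>
  have y: "v - x \<in> (*\<^sub>R) (1 - l) ` K"
    using scaled_mono[OF cvx zero, of m "1 - l"] lm by auto
  then obtain j where j: "j \<in> K" "v - x = (1 - l) *\<^sub>R j" by auto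
  have e: "v = (1 - l) *\<^sub>R j + l *\<^sub>R k" using j k by (metis diff_add_cancel)
  consider "l = 0" | "l = 1" | "0 < l" "l < 1" using lm by fastforce
  then show ?thesis
  proof cases
    case 1 then show ?thesis using k by auto
  next
    case 2 then show ?thesis using j k by (auto intro!: exI[of _ 1])
  next
    case 3
    have "j = k"
    proof (rule ccontr)
      assume "j \<noteq> k"
      then have "v \<in> open_segment j k" using 3 e by (auto simp: in_segment)
      then show False using v j k by (auto simp: extreme_point_of_def)
    qed
    then have "v = k" using e by (simp add: algebra_simps)
    then show ?thesis using k lm by auto
  qed
qed

text \<open>Of two different extreme points on one ray the nearer would lie in the open segment from
  0 to the farther.\<close>

lemma extreme_parallel:
  assumes "v extreme_point_of K" "q extreme_point_of K" "v \<noteq> 0" "q \<noteq> 0" "0 \<le> a" "v = a *\<^sub>R q"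
  shows "v = q"
proof -
  have *: False if "u extreme_point_of K" "w extreme_point_of K" "u \<noteq> 0" "w \<noteq> 0" "0 < b" "b < 1" "u = b *\<^sub>R w" for u w b
  proof -
    have "u \<in> open_segment 0 w" using that by (auto simp: in_segment)
    then show False using that zero by (auto simp: extreme_point_of_def)
  qed
  have "a \<noteq> 0" using assms by auto
  then consider "0 < a" "a < 1" | "a = 1" | "0 < inverse a" "inverse a < 1" using assms(5)
    by (metis inverse_less_1_iff inverse_positive_iff_positive linorder_neqE_linordered_idom order_less_le)
  then show ?thesis
  proof cases
    case 1
    then show ?thesis using *[OF assms(1-4)] assms(6) by blast
  next
    case 2
    then show ?thesis using assms(6) by simp
  next
    case 3
    have "q = inverse a *\<^sub>R v" using assms(6) \<open>a \<noteq> 0\<close> by simp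
    then show ?thesis using *[OF assms(2,1,4,3) 3] by blast
  qed
qed

text \<open>An interpolant \<open>s\<close> above 0 and \<open>r\<close> and below \<open>q\<close>
  and the multiple of \<open>v\<close> lies on both rays by \<open>extreme_ray\<close>, hence is 0.
  This is disjointness expressed by lower bounds: a common lower bound is \<le> 0.\<close>

lemma extreme_disjoint:
  assumes "v extreme_point_of K" "v \<noteq> 0" "q extreme_point_of K" "q \<noteq> 0" "v \<noteq> q" "0 \<le> a"
    and r: "a *\<^sub>R v - r \<in> gen_cone K" "q - r \<in> gen_cone K"
  shows "- r \<in> gen_cone K"
proof -
  have "a *\<^sub>R v \<in> gen_cone K" "q \<in> gen_cone K"
    using assms gen_cone_subset gen_cone_scale[of a v K] by (auto simp: extreme_point_of_def)
  from interp[OF this r] obtain s where s: "s \<in> gen_cone K" "a *\<^sub>R v - s \<in> gen_cone K"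
    "q - s \<in> gen_cone K" "s - r \<in> gen_cone K" by blast
  obtain b where b: "b \<ge> 0" "s = b *\<^sub>R q" using extreme_ray[of q s] s assms by auto
  have "s = 0"
  proof (cases "a = 0")
    case True then show ?thesis using s pointed by auto
  next
    case False
    then have "inverse a *\<^sub>R s \<in> gen_cone K" "v - inverse a *\<^sub>R s \<in> gen_cone K"
      using gen_cone_scale[OF _ s(1), of "inverse a"] gen_cone_scale[OF _ s(2), of "inverse a"] assms(6)
      by (auto simp: algebra_simps)
    then obtain c where c: "c \<ge> 0" "inverse a *\<^sub>R s = c *\<^sub>R v" using extreme_ray[of v] assms by blast
    show ?thesis
    proof (rule ccontr)
      assume "s \<noteq> 0"
      then have "c \<noteq> 0" using c False by auto
      then have "v = (inverse c * inverse a * b) *\<^sub>R q" using c b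
        by (metis (no_types, lifting) divideR_right scaleR_scaleR inverse_eq_divide scaleR_one real_vector_affinity_eq left_inverse)
      moreover have "0 \<le> inverse c * inverse a * b" using b c assms by simp
      ultimately show False using extreme_parallel[of v q] assms by blast
    qed
  qed
  then show ?thesis using s by simp
qed

text \<open>Induction that subtracts one summand from \<open>r\<close>: the difference is below the
  remaining sum and, the summand being positive, still below \<open>q\<close>. The induction
  hypothesis then puts \<open>r\<close> below that single summand, and
  \<open>extreme_disjoint\<close> applies.\<close>

lemma extreme_disjoint_sum:
  assumes "finite T" "\<And>v. v \<in> T \<Longrightarrow> v extreme_point_of K \<and> v \<noteq> 0 \<and> v \<noteq> q \<and> 0 \<le> a v"
    and q: "q extreme_point_of K" "q \<noteq> 0"
    and "(\<Sum>v\<in>T. a v *\<^sub>R v) - r \<in> gen_cone K" "q - r \<in> gen_cone K"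
  shows "- r \<in> gen_cone K"
  using assms(1,2,5,6)
proof (induction T arbitrary: r rule: finite_induct)
  case (insert v T)
  have v: "v extreme_point_of K" "v \<noteq> 0" "v \<noteq> q" "0 \<le> a v" using insert.prems by auto
  have av: "a v *\<^sub>R v \<in> gen_cone K"
    using v gen_cone_subset[of K] by (intro gen_cone_scale) (auto simp: extreme_point_of_def)
  have "- (r - a v *\<^sub>R v) \<in> gen_cone K"
  proof (rule insert.IH)
    show "(\<Sum>v\<in>T. a v *\<^sub>R v) - (r - a v *\<^sub>R v) \<in> gen_cone K"
      using insert.prems(2) by (simp add: sum.insert[OF insert.hyps] add_diff_eq add.commute diff_diff_eq2)
    show "q - (r - a v *\<^sub>R v) \<in> gen_cone K"
      using gen_cone_add[OF cvx insert.prems(3) av] by (simp add: diff_diff_eq2 diff_add_eq)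
  qed (use insert.prems(1) in blast)
  then have "a v *\<^sub>R v - r \<in> gen_cone K" by simp
  then show ?case using extreme_disjoint[OF v(1,2) q v(3,4)] insert.prems(3) by blast
qed simp

text \<open>In a linear relation expressing an extreme point \<open>q\<close> by others, the
  coefficients are split by sign. Then \<open>q\<close> is below the positive part and, trivially,
  below itself, so disjointness gives \<open>q\<close> \<le> 0 and pointedness
  \<open>q = 0\<close>.\<close>

lemma simplex: "simplex_with_vertices K {x. x extreme_point_of K}"
proof -
  let ?V = "{x. x extreme_point_of K}"
  have hull: "K = convex hull ?V"
    using body by (intro Krein_Milman_Minkowski) (auto simp: convex_body_def)
  have "independent (?V - {0})"
  proof
    assume "dependent (?V - {0})"
    then obtain q where q: "q \<in> ?V - {0}" "q \<in> span (?V - {0} - {q})"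
      unfolding dependent_def by blast
    from q(2) obtain T a where T: "finite T" "T \<subseteq> ?V - {0} - {q}" "q = (\<Sum>v\<in>T. a v *\<^sub>R v)"
      unfolding span_explicit by blast
    have "q = (\<Sum>v\<in>T. max 0 (a v) *\<^sub>R v) - (\<Sum>v\<in>T. max 0 (- a v) *\<^sub>R v)"
      unfolding T(3) sum_subtractf[symmetric]
      by (intro sum.cong refl) (auto simp: max_def simp flip: scaleR_left_diff_distrib)
    moreover have "(\<Sum>v\<in>T. max 0 (- a v) *\<^sub>R v) \<in> gen_cone K"
      using T(1,2)
    proof (induction T rule: finite_induct)
      case (insert v T)
      then have "v \<in> K" by (auto simp: extreme_point_of_def)
      then show ?case using insert gen_cone_subset
        by (auto intro!: gen_cone_add[OF cvx] gen_cone_scale)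
    qed (simp add: zero_gen_cone)
    ultimately have "(\<Sum>v\<in>T. max 0 (a v) *\<^sub>R v) - q \<in> gen_cone K" by simp
    moreover have "q - q \<in> gen_cone K" by (simp add: zero_gen_cone)
    ultimately have "- q \<in> gen_cone K"
      using T q by (intro extreme_disjoint_sum[of T q]) auto
    moreover have "q \<in> gen_cone K" using q gen_cone_subset by (auto simp: extreme_point_of_def)
    ultimately show False using pointed q by blast
  qed
  then have "\<not> affine_dependent (insert 0 (?V - {0}))"
    by (subst affine_dependent_iff_dependent) auto
  then have "\<not> affine_dependent ?V"
    using zero_extreme by (simp add: insert_absorb)
  then show ?thesis using hull by (simp add: simplex_with_vertices_def)
qed

end

section \<open>From homothetic fibres to the order axioms\<close>

text \<open>The intersection of a cone narrowing upwards to its apex \<open>(0, 1)\<close> with one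
  opening upwards from \<open>(- y, 0)\<close>. With \<open>c = (1 - t) / t\<close> it is the fibre
  of C over \<open>diag (t *\<^sub>R y)\<close>, see \<open>join_lift_fibre\<close>.\<close>

definition cone_fibre :: "real \<Rightarrow> 'a::real_vector set \<Rightarrow> 'a \<Rightarrow> ('a \<times> real) set" where
  "cone_fibre c K y = {(x, \<theta>). \<theta> \<in> {0..1} \<and> x \<in> (*\<^sub>R) (1 - \<theta>) ` K \<and> x + y \<in> (*\<^sub>R) (c * \<theta>) ` K}"

text \<open>The homothety sends the tips \<open>(0, 0)\<close> and \<open>(0, 1)\<close> of the
  fibre over 0 to \<open>g\<close> and to the point at height \<open>s\<close> above
  \<open>g\<close>. Axiom \<open>split\<close> comes from the shift by a small negative multiple of
  \<open>x\<close>, axiom \<open>interp\<close> from the shift by a small multiple of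
  \<open>u - w\<close>.\<close>

lemma split_body_if_fibres_homothetic:
  fixes K :: "'a::euclidean_space set"
  assumes body: "convex_body K" and zero: "0 \<in> K" and c: "0 < c" and e: "0 < e"
    and hom: "\<And>y. norm y < e \<Longrightarrow>
      \<exists>g s. 0 < s \<and> cone_fibre c K y = (\<lambda>v. g + s *\<^sub>R v) ` cone_fibre c K 0"
  shows "split_body K"
proof
  show "convex_body K" "0 \<in> K" by fact+
  have cvx: "convex K" using body by (simp add: convex_body_def)
  have ev_small: "eventually (\<lambda>h. norm (h *\<^sub>R y) < e) (at_right 0)" for y :: 'a
  proof -
    have "((\<lambda>h. norm (h *\<^sub>R y)) \<longlongrightarrow> norm (0 *\<^sub>R y)) (at_right 0)" by (intro tendsto_intros)
    then show ?thesis using e by (intro order_tendstoD(2)) auto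
  qed
  have ev_pos: "eventually (\<lambda>h::real. 0 < h) (at_right 0)" by (simp add: eventually_at_right_less)
  note ev_mem = eventually_gen_cone_scaled_mem[OF cvx zero]
  have ends: "(0, 0) \<in> cone_fibre c K 0" "(0, 1) \<in> cone_fibre c K 0"
    using zero by (auto simp: cone_fibre_def image_iff intro: bexI[of _ 0])
  {
    fix x y a assume xy: "x \<in> gen_cone K" "y \<in> gen_cone K" and a: "0 \<le> a" "x + y \<in> (*\<^sub>R) a ` K"
    have ev_a: "eventually (\<lambda>h. h * a < 1/2) (at_right 0)"
    proof -
      have "((\<lambda>h. h * a) \<longlongrightarrow> 0 * a) (at_right 0)" by (intro tendsto_intros)
      then show ?thesis by (intro order_tendstoD(2)) auto
    qed
    have "eventually (\<lambda>h. 0 < h \<and> h * a < 1/2 \<and> norm (h *\<^sub>R (- x)) < e \<and>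
        h *\<^sub>R x \<in> (*\<^sub>R) 1 ` K \<and> h *\<^sub>R y \<in> (*\<^sub>R) (c / 2) ` K) (at_right 0)"
      using c xy by (intro eventually_conj ev_pos ev_a ev_small ev_mem) auto
    from eventually_happens'[OF trivial_limit_at_right_real this] obtain h where h: "0 < h" "h * a < 1/2" "norm (- (h *\<^sub>R x)) < e"
      "h *\<^sub>R x \<in> (*\<^sub>R) 1 ` K" "h *\<^sub>R y \<in> (*\<^sub>R) (c / 2) ` K"
      unfolding scaleR_minus_right by blast
    obtain g s where s: "0 < s" and F: "cone_fibre c K (- (h *\<^sub>R x)) = (\<lambda>v. g + s *\<^sub>R v) ` cone_fibre c K 0"
      using hom[OF h(3)] by blast
    obtain p th where g: "g = (p, th)" by (cases g)
    \<comment> \<open>The apex of the opening cone belongs to this fibre and is its only point at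
      height 0, so it has to be the image of the lower tip.\<close>
    have "(h *\<^sub>R x, 0) \<in> cone_fibre c K (- (h *\<^sub>R x))"
      using h(4) zero by (auto simp: cone_fibre_def)
    then obtain x1 th1 where "(x1, th1) \<in> cone_fibre c K 0" "0 = th + s * th1" using F g by auto
    then have "0 \<le> th1" "0 = th + s * th1" by (auto simp: cone_fibre_def)
    then have "th \<le> 0" using s mult_nonneg_nonneg[of s th1] by linarith
    have "(p, th) \<in> cone_fibre c K (- (h *\<^sub>R x))" using imageI[OF ends(1), of "\<lambda>v. g + s *\<^sub>R v"] F g by simp
    with \<open>th \<le> 0\<close> have th: "th = 0" and p: "p = h *\<^sub>R x" by (auto simp: cone_fibre_def)
    \<comment> \<open>The image of the upper tip is \<open>(h *\<^sub>R x, s)\<close>; the narrowing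
      cone at that height puts \<open>h *\<^sub>R x\<close> into the \<open>(1 - s)\<close>-multiple
      of \<open>K\<close>.\<close>
    have "(p, th + s) \<in> cone_fibre c K (- (h *\<^sub>R x))" using imageI[OF ends(2), of "\<lambda>v. g + s *\<^sub>R v"] F g by simp
    then have s1: "s \<le> 1" "h *\<^sub>R x \<in> (*\<^sub>R) (1 - s) ` K" using th p by (auto simp: cone_fibre_def)
    \<comment> \<open>At height \<open>1 - h * a\<close> the narrowing cone has exactly the factor
      \<open>h * a\<close>, so the scaled sum is a point of the fibre. Pulling it back by the
      homothety leaves the factor \<open>h * a - (1 - s)\<close> for
      \<open>h *\<^sub>R y\<close>.\<close>
    have "h *\<^sub>R (x + y) \<in> (*\<^sub>R) (h * a) ` K" using scaled_scaled[OF a(2)] .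
    moreover have "h *\<^sub>R y \<in> (*\<^sub>R) (c * (1 - h * a)) ` K"
      using h c by (intro scaled_mono[OF cvx zero _ _ h(5)]) auto
    ultimately have "(h *\<^sub>R (x + y), 1 - h * a) \<in> cone_fibre c K (- (h *\<^sub>R x))"
      using h a by (auto simp: cone_fibre_def algebra_simps)
    then obtain y1 ph where y1: "(y1, ph) \<in> cone_fibre c K 0" "h *\<^sub>R (x + y) = h *\<^sub>R x + s *\<^sub>R y1" "1 - h * a = s * ph"
      using F g p th by auto
    then have "y1 \<in> (*\<^sub>R) (1 - ph) ` K" "ph \<le> 1" by (auto simp: cone_fibre_def)
    moreover have "h *\<^sub>R y = s *\<^sub>R y1" using y1 by (simp add: algebra_simps)
    ultimately have "h *\<^sub>R y \<in> (*\<^sub>R) (s * (1 - ph)) ` K" using scaled_scaled by metis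
    moreover have eq: "s * (1 - ph) = h * a - (1 - s)" using y1(3) by (simp add: algebra_simps)
    ultimately have m: "h *\<^sub>R y \<in> (*\<^sub>R) (h * a - (1 - s)) ` K" by simp
    have m0: "0 \<le> h * a - (1 - s)"
      using mult_nonneg_nonneg[of s "1 - ph"] s \<open>ph \<le> 1\<close> unfolding eq by simp
    have hh: "h * ((1 - s) / h) = 1 - s" "h * (a - (1 - s) / h) = h * a - (1 - s)"
      using h by (simp_all add: field_simps)
    have "h \<noteq> 0" using h by simp
    from scaled_scaled_iff[OF this, of x "(1 - s) / h" K] scaled_scaled_iff[OF this, of y "a - (1 - s) / h" K]
    have "x \<in> (*\<^sub>R) ((1 - s) / h) ` K" "y \<in> (*\<^sub>R) (a - (1 - s) / h) ` K"
      unfolding hh using s1(2) m by blast+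
    moreover have "0 \<le> (1 - s) / h" using s1 h by simp
    moreover have "0 \<le> a - (1 - s) / h" using m0 h by (simp add: field_simps)
    ultimately show "\<exists>l m. 0 \<le> l \<and> 0 \<le> m \<and> l + m \<le> a \<and> x \<in> (*\<^sub>R) l ` K \<and> y \<in> (*\<^sub>R) m ` K"
      by (intro exI[of _ "(1 - s) / h"] exI[of _ "a - (1 - s) / h"]) simp
  }
  {
    fix u w v assume uwv: "u \<in> gen_cone K" "w \<in> gen_cone K" "u - v \<in> gen_cone K" "w - v \<in> gen_cone K"
    have "eventually (\<lambda>h. 0 < h \<and> norm (h *\<^sub>R (u - w)) < e \<and>
        h *\<^sub>R w \<in> (*\<^sub>R) (1 / 2) ` K \<and> h *\<^sub>R u \<in> (*\<^sub>R) (c / 2) ` K \<and>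
        h *\<^sub>R (w - v) \<in> (*\<^sub>R) (1 / 2) ` K \<and> h *\<^sub>R (u - v) \<in> (*\<^sub>R) (c / 2) ` K) (at_right 0)"
      using c uwv by (intro eventually_conj ev_pos ev_small ev_mem) auto
    from eventually_happens'[OF trivial_limit_at_right_real this] obtain h where h: "0 < h" "norm (h *\<^sub>R (u - w)) < e"
      "h *\<^sub>R w \<in> (*\<^sub>R) (1 / 2) ` K" "h *\<^sub>R u \<in> (*\<^sub>R) (c / 2) ` K"
      "h *\<^sub>R (w - v) \<in> (*\<^sub>R) (1 / 2) ` K" "h *\<^sub>R (u - v) \<in> (*\<^sub>R) (c / 2) ` K"
      by blast
    obtain g s where s: "0 < s" and F: "cone_fibre c K (h *\<^sub>R (u - w)) = (\<lambda>v. g + s *\<^sub>R v) ` cone_fibre c K 0"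
      using hom[OF h(2)] by blast
    obtain p th where g: "g = (p, th)" by (cases g)
    \<comment> \<open>The fibre over 0 has its first components in N, so in the order of N the image
      \<open>p\<close> of the lower tip is least among the first components of this fibre. It stands
      in for the supremum of 0 and \<open>h *\<^sub>R (w - u)\<close>.\<close>
    have least: "x - p \<in> gen_cone K" if mem: "(x, th') \<in> cone_fibre c K (h *\<^sub>R (u - w))" for x th'
    proof -
      obtain x1 th1 where x1: "(x1, th1) \<in> cone_fibre c K 0" "x = p + s *\<^sub>R x1"
        using mem unfolding F g by auto
      then have "0 \<le> 1 - th1" "x1 \<in> (*\<^sub>R) (1 - th1) ` K" by (simp_all add: cone_fibre_def)
      then have "x1 \<in> gen_cone K" by (rule gen_coneI)
      then show ?thesis using gen_cone_scale[of s x1 K] s x1 by simp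
    qed
    have "(p, th) \<in> cone_fibre c K (h *\<^sub>R (u - w))" using imageI[OF ends(1), of "\<lambda>v. g + s *\<^sub>R v"] F g by simp
    then have "0 \<le> 1 - th" "p \<in> (*\<^sub>R) (1 - th) ` K" "0 \<le> c * th" "p + h *\<^sub>R (u - w) \<in> (*\<^sub>R) (c * th) ` K"
      using c by (simp_all add: cone_fibre_def)
    then have p: "p \<in> gen_cone K" "p + h *\<^sub>R (u - w) \<in> gen_cone K"
      by (blast intro: gen_coneI)+
    have "h *\<^sub>R w + h *\<^sub>R (u - w) = h *\<^sub>R u" by (simp add: scaleR_right_diff_distrib)
    then have "(h *\<^sub>R w, 1/2) \<in> cone_fibre c K (h *\<^sub>R (u - w))"
      using h by (simp add: cone_fibre_def)
    from least[OF this] have r: "h *\<^sub>R w - p \<in> gen_cone K" .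
    have "h *\<^sub>R (w - v) + h *\<^sub>R (u - w) = h *\<^sub>R (u - v)" by (simp add: scaleR_right_diff_distrib)
    then have "(h *\<^sub>R (w - v), 1/2) \<in> cone_fibre c K (h *\<^sub>R (u - w))"
      using h by (simp add: cone_fibre_def)
    from least[OF this] have r': "h *\<^sub>R (w - v) - p \<in> gen_cone K" .
    \<comment> \<open>Modelled on the lattice identity that the infimum of \<open>u\<close> and
      \<open>w\<close> is \<open>w\<close> minus the positive part of \<open>w - u\<close>.\<close>
    define r where "r = w - inverse h *\<^sub>R p"
    have [simp]: "h *\<^sub>R r = h *\<^sub>R w - p" using h by (simp add: r_def algebra_simps)
    have "h *\<^sub>R (u - r) = p + h *\<^sub>R (u - w)" "h *\<^sub>R (w - r) = p"
      "h *\<^sub>R (r - v) = h *\<^sub>R (w - v) - p"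
      by (simp_all add: scaleR_right_diff_distrib)
    then have "h *\<^sub>R r \<in> gen_cone K" "h *\<^sub>R (u - r) \<in> gen_cone K" "h *\<^sub>R (w - r) \<in> gen_cone K" "h *\<^sub>R (r - v) \<in> gen_cone K"
      using r r' p by simp_all
    then show "\<exists>r. r \<in> gen_cone K \<and> u - r \<in> gen_cone K \<and> w - r \<in> gen_cone K \<and> r - v \<in> gen_cone K"
      unfolding gen_cone_scale_iff[OF h(1)] by blast
  }
qed

section \<open>Sections and projections of convex bodies\<close>

lemma emeasure_lborel_affine:
  fixes S :: "'a::euclidean_space set"
  assumes "compact S"
  shows "emeasure lborel ((\<lambda>x. a + r *\<^sub>R x) ` S) = ennreal (\<bar>r\<bar> ^ DIM('a)) * emeasure lborel S"
proof -
  have "compact ((\<lambda>x. a + r *\<^sub>R x) ` S)"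
    by (intro compact_continuous_image continuous_intros assms)
  then have "(\<lambda>x. a + r *\<^sub>R x) ` S \<in> sets lborel" "S \<in> sets lborel"
    using assms by (auto intro: borel_compact)
  then show ?thesis
    using emeasure_lebesgue_affine[of r a S] by (simp add: add.commute emeasure_completion ennreal_power)
qed

lemma emeasure_lborel_scaled:
  fixes S :: "'a::euclidean_space set"
  assumes "compact S" "0 \<le> r"
  shows "emeasure lborel ((*\<^sub>R) r ` S) = ennreal (r ^ DIM('a)) * emeasure lborel S"
  using emeasure_lborel_affine[OF assms(1), of 0 r] assms(2) by simp

text \<open>A point of \<open>B - A\<close> would be a limit of interior points of \<open>B\<close>,
  so removing \<open>A\<close> from the interior of \<open>B\<close> would leave a nonempty open set
  inside a null set.\<close>

lemma convex_eq_if_emeasure_eq: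
  fixes A B :: "'a::euclidean_space set"
  assumes "compact A" "A \<subseteq> B" "compact B" "convex B"
    and eq: "emeasure lborel B \<le> emeasure lborel A" and pos: "emeasure lborel A \<noteq> 0"
  shows "A = B"
proof (rule ccontr)
  assume "A \<noteq> B"
  then obtain b where b: "b \<in> B" "b \<notin> A" using assms(2) by blast
  have meas: "A \<in> sets lborel" "B \<in> sets lborel" using assms by (auto intro: borel_compact)
  have fin: "emeasure lborel A \<noteq> \<infinity>" "emeasure lborel B \<noteq> \<infinity>"
    using emeasure_compact_finite[OF assms(1)] emeasure_compact_finite[OF assms(3)] by auto
  have "emeasure lborel A = emeasure lborel B" using eq emeasure_mono[OF assms(2), of lborel] meas by (intro antisym) auto
  then have "emeasure lborel (B - A) = 0"
    using emeasure_Diff[OF fin(1) meas(2,1) assms(2)] fin by simp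
  then have null: "negligible (B - A)"
    unfolding negligible_iff_null_sets using meas by (intro null_sets_completionI null_setsI) auto
  have "\<not> negligible B"
  proof
    assume "negligible B"
    then have "emeasure lebesgue B = 0" by (simp add: negligible_iff_null_sets null_setsD1)
    then have "emeasure lborel B = 0" using meas by simp
    then show False using pos emeasure_mono[OF assms(2), of lborel] meas by simp
  qed
  then have "interior B \<noteq> {}" using assms negligible_convex_interior by blast
  then have "b \<in> closure (interior B)"
    using b closure_subset unfolding convex_closure_interior[OF assms(4) \<open>interior B \<noteq> {}\<close>] by blast
  moreover have "open (- A)" "b \<in> - A" using b assms(1) by (auto simp: compact_imp_closed)
  ultimately have "- A \<inter> interior B \<noteq> {}"
    by (metis Int_commute open_Int_closure_eq_empty disjoint_iff)
  moreover have "open (- A \<inter> interior B)" using \<open>open (- A)\<close> by blast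
  ultimately have "\<not> negligible (- A \<inter> interior B)" using open_not_negligible by blast
  moreover have "- A \<inter> interior B \<subseteq> B - A" using interior_subset by blast
  ultimately show False using null negligible_subset by blast
qed

lemma nn_integral_one_minus_power:
  assumes "0 < m" "s \<le> 1"
  shows "(\<integral>\<^sup>+r. ennreal (real m * (1 - r) ^ (m - 1)) * indicator {s..1} r \<partial>lborel) = ennreal ((1 - s) ^ m)"
proof -
  have "(\<integral>\<^sup>+r. ennreal (real m * (1 - r) ^ (m - 1)) * indicator {s..1} r \<partial>lborel)
      = ennreal (- ((1 - 1) ^ m) - (- ((1 - s) ^ m)))"
    using assms by (intro nn_integral_FTC_Icc)
      (auto intro!: derivative_eq_intros simp: Suc_diff_Suc algebra_simps)
  then show ?thesis using assms by (simp add: zero_power)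
qed

text \<open>Euler's Beta integral B(k + 1, d + 1), left unevaluated: it cancels once it is known to
  be nonzero and finite.\<close>

definition beta_nat :: "nat \<Rightarrow> nat \<Rightarrow> ennreal" where
  "beta_nat k d = (\<integral>\<^sup>+r. ennreal ((1 - r) ^ k * r ^ d) * indicator {0..1} r \<partial>lborel)"

section \<open>Convex bodies fibred over a projection that contains the origin\<close>

locale fibred_body =
  fixes C :: "('a::euclidean_space \<times> 'b::euclidean_space) set"
  assumes compact: "compact C" and convex: "convex C" and zero: "Pair 0 -` C \<noteq> {}"
begin

abbreviation "fibre z \<equiv> Pair z -` C"
abbreviation "base \<equiv> fst ` C"

text \<open>The gauge of the projection, meaningful on \<open>base\<close> only: elsewhere the
  infimum is taken over the empty set.\<close>

definition depth :: "'a \<Rightarrow> real" where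
  "depth z = Inf {r \<in> {0..1}. z \<in> (*\<^sub>R) r ` base}"

lemma compact_base: "compact base"
  by (intro compact_continuous_image compact continuous_intros)

lemma convex_base: "convex base"
  by (intro convex_linear_image convex linear_fst)

lemma zero_base: "0 \<in> base" using zero by force

lemma compact_fibre: "compact (fibre z)"
proof -
  have "fibre z = snd ` (C \<inter> ({z} \<times> UNIV))" by force
  moreover have "compact (C \<inter> ({z} \<times> UNIV))"
    by (intro compact_Int_closed compact closed_Times) auto
  ultimately show ?thesis by (auto intro!: compact_continuous_image continuous_intros)
qed

lemma convex_fibre: "convex (fibre z)"
proof (rule convexI)
  fix x y and u v :: real assume *: "x \<in> fibre z" "y \<in> fibre z" "0 \<le> u" "0 \<le> v" "u + v = 1"
  then have "u *\<^sub>R (z, x) + v *\<^sub>R (z, y) \<in> C" by (intro convexD[OF convex]) auto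
  moreover have "u *\<^sub>R z + v *\<^sub>R z = z" using * by (metis scaleR_left_distrib scaleR_one)
  ultimately show "u *\<^sub>R x + v *\<^sub>R y \<in> fibre z" by simp
qed

lemma scaled_base_mono:
  assumes "0 \<le> r" "r \<le> s" "z \<in> (*\<^sub>R) r ` base"
  shows "z \<in> (*\<^sub>R) s ` base"
proof (cases "s = 0")
  case False
  obtain b where b: "b \<in> base" "z = r *\<^sub>R b" using assms by blast
  have "(1 - r / s) *\<^sub>R 0 + (r / s) *\<^sub>R b \<in> base"
    using assms False by (intro convexD[OF convex_base zero_base b(1)]) auto
  moreover have "z = s *\<^sub>R ((1 - r / s) *\<^sub>R 0 + (r / s) *\<^sub>R b)" using b False by simp
  ultimately show ?thesis by blast
qed (use assms in auto)

lemma compact_cone: "closed S \<Longrightarrow> S \<subseteq> {0..1} \<Longrightarrow> compact {(z, r). r \<in> S \<and> z \<in> (*\<^sub>R) r ` base}"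
proof -
  assume S: "closed S" "S \<subseteq> {0..1::real}"
  have "compact S" using S compact_Int_closed[of "{0..1}" S] by (simp add: Int_absorb1)
  then have "compact ((\<lambda>(b, r). (r *\<^sub>R b, r)) ` (base \<times> S))"
    by (intro compact_continuous_image compact_Times compact_base) (auto simp: case_prod_unfold intro!: continuous_intros)
  moreover have "(\<lambda>(b, r). (r *\<^sub>R b, r)) ` (base \<times> S) = {(z, r). r \<in> S \<and> z \<in> (*\<^sub>R) r ` base}"
    by force
  ultimately show ?thesis by simp
qed

text \<open>Lower semicontinuity of \<open>depth\<close>, phrased without \<open>depth\<close> so
  that it covers points off \<open>base\<close>. The set is a projection of a compact cone.\<close>

lemma closed_sublevel: "closed {z. \<exists>r\<in>{0..1}. r \<le> c \<and> z \<in> (*\<^sub>R) r ` base}"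
proof -
  have "compact {(z, r). r \<in> {0..1} \<inter> {..c} \<and> z \<in> (*\<^sub>R) r ` base}"
    by (intro compact_cone) auto
  then have "compact (fst ` {(z, r). r \<in> {0..1} \<inter> {..c} \<and> z \<in> (*\<^sub>R) r ` base})"
    by (intro compact_continuous_image continuous_intros)
  moreover have "fst ` {(z, r). r \<in> {0..1} \<inter> {..c} \<and> z \<in> (*\<^sub>R) r ` base}
      = {z. \<exists>r\<in>{0..1}. r \<le> c \<and> z \<in> (*\<^sub>R) r ` base}" by force
  ultimately show ?thesis by (simp add: compact_imp_closed)
qed

lemma depth:
  assumes "z \<in> base"
  shows depth_range: "depth z \<in> {0..1}" and depth_mem: "z \<in> (*\<^sub>R) (depth z) ` base"
    and depth_le: "\<And>r. r \<in> {0..1} \<Longrightarrow> z \<in> (*\<^sub>R) r ` base \<longleftrightarrow> depth z \<le> r"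
proof -
  let ?R = "{r \<in> {0..1}. z \<in> (*\<^sub>R) r ` base}"
  have "?R = snd ` ({(z, r). r \<in> {0..1} \<and> z \<in> (*\<^sub>R) r ` base} \<inter> {z} \<times> UNIV)" by force
  moreover have "compact ({(z, r). r \<in> {0..1} \<and> z \<in> (*\<^sub>R) r ` base} \<inter> {z} \<times> UNIV)"
    by (intro compact_Int_closed compact_cone closed_Times) auto
  ultimately have "closed ?R"
    by (auto intro!: compact_imp_closed compact_continuous_image continuous_intros)
  moreover have "1 \<in> ?R" using assms by simp
  moreover have bdd: "bdd_below ?R" by (rule bdd_belowI[of _ 0]) auto
  ultimately have *: "depth z \<in> ?R" unfolding depth_def by (intro closed_contains_Inf) blast+
  then show "depth z \<in> {0..1}" "z \<in> (*\<^sub>R) (depth z) ` base" by auto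
  show "z \<in> (*\<^sub>R) r ` base \<longleftrightarrow> depth z \<le> r" if r: "r \<in> {0..1}" for r
  proof
    assume "z \<in> (*\<^sub>R) r ` base"
    then show "depth z \<le> r" using r bdd unfolding depth_def by (intro cInf_lower) auto
  next
    assume "depth z \<le> r"
    then show "z \<in> (*\<^sub>R) r ` base" using * scaled_base_mono[of "depth z" r z] by auto
  qed
qed

text \<open>Convexity joins the whole fibre over \<open>w\<close> to a single point of the fibre
  over \<open>b\<close>.\<close>

lemma fibre_shrink:
  assumes "0 \<le> r" "r \<le> 1" "b \<in> base"
  shows "\<exists>g. (\<lambda>v. g + (1 - r) *\<^sub>R v) ` fibre w \<subseteq> fibre ((1 - r) *\<^sub>R w + r *\<^sub>R b)"
proof -
  obtain g where g: "(b, g) \<in> C" using assms by force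
  have "(1 - r) *\<^sub>R (w, v) + r *\<^sub>R (b, g) \<in> C" if "v \<in> fibre w" for v
    using that assms g by (intro convexD[OF convex]) auto
  then show ?thesis by (intro exI[of _ "r *\<^sub>R g"]) (auto simp: add.commute)
qed

lemma emeasure_fibre_shrink:
  assumes "0 \<le> r" "r \<le> 1" "b \<in> base"
  shows "ennreal ((1 - r) ^ DIM('b)) * emeasure lborel (fibre w)
    \<le> emeasure lborel (fibre ((1 - r) *\<^sub>R w + r *\<^sub>R b))"
proof -
  obtain g where g: "(\<lambda>v. g + (1 - r) *\<^sub>R v) ` fibre w \<subseteq> fibre ((1 - r) *\<^sub>R w + r *\<^sub>R b)"
    using fibre_shrink[OF assms] by blast
  then have "emeasure lborel ((\<lambda>v. g + (1 - r) *\<^sub>R v) ` fibre w)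
      \<le> emeasure lborel (fibre ((1 - r) *\<^sub>R w + r *\<^sub>R b))"
    using compact_fibre by (intro emeasure_mono) (auto intro: borel_compact)
  then show ?thesis using assms by (simp add: emeasure_lborel_affine[OF compact_fibre])
qed

text \<open>Written as an integral over \<open>r\<close> so that Tonelli's theorem applies and no measurability of
  \<open>depth\<close> is needed.\<close>

definition cone_weight :: "'a \<Rightarrow> ennreal" where
  "cone_weight z = (\<integral>\<^sup>+r. ennreal (real DIM('b) * (1 - r) ^ (DIM('b) - 1)) *
     indicator {(z, r). r \<in> {0..1} \<and> z \<in> (*\<^sub>R) r ` base} (z, r) \<partial>lborel)"

lemma cone_weight_eq:
  "cone_weight z = (if z \<in> base then ennreal ((1 - depth z) ^ DIM('b)) else 0)"
proof (cases "z \<in> base")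
  case True
  have "indicator {(z, r). r \<in> {0..1} \<and> z \<in> (*\<^sub>R) r ` base} (z, r) = (indicator {depth z..1} r :: ennreal)" for r
    using depth_le[OF True, of r] depth_range[OF True] by (auto simp: indicator_def)
  then show ?thesis unfolding cone_weight_def
    using nn_integral_one_minus_power[of "DIM('b)" "depth z"] depth_range[OF True] True by simp
next
  case False
  have "z \<notin> (*\<^sub>R) r ` base" if "r \<in> {0..1}" for r
    using False scaled_base_mono[of r 1 z] that by auto
  then have "indicator {(z, r). r \<in> {0..1} \<and> z \<in> (*\<^sub>R) r ` base} (z, r) = (0::ennreal)" for r
    by (simp add: indicator_def)
  then show ?thesis unfolding cone_weight_def using False by simp
qed

text \<open>Among the representations of \<open>z\<close> as \<open>r *\<^sub>R b\<close> with
  \<open>b\<close> in the projection, \<open>r = depth z\<close> shrinks the fibre over 0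
  least.\<close>

lemma cone_weight_fibre: "emeasure lborel (fibre 0) * cone_weight z \<le> emeasure lborel (fibre z)"
proof (cases "z \<in> base")
  case True
  obtain b where "b \<in> base" "z = depth z *\<^sub>R b" using depth_mem[OF True] by blast
  then show ?thesis
    using emeasure_fibre_shrink[of "depth z" b 0] depth_range[OF True] True by (simp add: cone_weight_eq mult.commute)
qed (simp add: cone_weight_eq)

lemma cone_measurable [measurable]:
  "{(z, r). r \<in> {0..1} \<and> z \<in> (*\<^sub>R) r ` base} \<in> sets (lborel \<Otimes>\<^sub>M lborel)"
  unfolding lborel_prod using compact_cone[of "{0..1}"] by (auto intro: borel_compact)

lemma cone_weight_measurable [measurable]: "cone_weight \<in> borel_measurable lborel"
  unfolding cone_weight_def by measurable

text \<open>With the order of integration exchanged, the inner integral over \<open>z\<close> is the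
  volume of a dilate of the projection, which supplies the power of \<open>r\<close>.\<close>

lemma nn_integral_cone_weight:
  "(\<integral>\<^sup>+z. cone_weight z \<partial>lborel) = emeasure lborel base * (of_nat DIM('b) * beta_nat (DIM('b) - 1) DIM('a))"
proof -
  let ?D = "{(z, r). r \<in> {0..1} \<and> z \<in> (*\<^sub>R) r ` base}"
  let ?w = "\<lambda>r. ennreal (real DIM('b) * (1 - r) ^ (DIM('b) - 1))"
  have "(\<integral>\<^sup>+z. cone_weight z \<partial>lborel) = (\<integral>\<^sup>+r. \<integral>\<^sup>+z. ?w r * indicator ?D (z, r) \<partial>lborel \<partial>lborel)"
    unfolding cone_weight_def by (rule lborel_pair.Fubini') measurable
  also have "\<dots> = (\<integral>\<^sup>+r. emeasure lborel base * (of_nat DIM('b) * (ennreal ((1 - r) ^ (DIM('b) - 1) * r ^ DIM('a)) * indicator {0..1} r)) \<partial>lborel)"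
  proof (intro nn_integral_cong)
    fix r :: real
    show "(\<integral>\<^sup>+z. ?w r * indicator ?D (z, r) \<partial>lborel)
      = emeasure lborel base * (of_nat DIM('b) * (ennreal ((1 - r) ^ (DIM('b) - 1) * r ^ DIM('a)) * indicator {0..1} r))"
    proof (cases "r \<in> {0..1}")
      case True
      have meas: "(*\<^sub>R) r ` base \<in> sets lborel"
        using compact_scaling[OF compact_base, of r] by (auto intro: borel_compact)
      have "(\<integral>\<^sup>+z. ?w r * indicator ?D (z, r) \<partial>lborel) = (\<integral>\<^sup>+z. ?w r * indicator ((*\<^sub>R) r ` base) z \<partial>lborel)"
        using True by (intro nn_integral_cong) (auto simp: indicator_def)
      also have "\<dots> = ?w r * (ennreal (r ^ DIM('a)) * emeasure lborel base)"
        using True by (simp only: nn_integral_cmult_indicator[OF meas]) (simp add: emeasure_lborel_scaled[OF compact_base])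
      finally show ?thesis using True by (simp add: ennreal_mult' mult_ac ennreal_of_nat_eq_real_of_nat)
    qed (auto simp: indicator_def)
  qed
  also have "\<dots> = emeasure lborel base * (of_nat DIM('b) * beta_nat (DIM('b) - 1) DIM('a))"
    unfolding beta_nat_def by (subst nn_integral_cmult, measurable)+
  finally show ?thesis .
qed

lemma C_measurable [measurable]: "C \<in> sets (lborel \<Otimes>\<^sub>M lborel)"
  unfolding lborel_prod using compact by (auto intro: borel_compact)

lemma emeasure_eq_fibres: "emeasure lborel C = (\<integral>\<^sup>+z. emeasure lborel (fibre z) \<partial>lborel)"
  using lborel.emeasure_pair_measure_alt[OF C_measurable] by (simp add: lborel_prod)

theorem section_times_projection_le:
  "emeasure lborel (fibre 0) * (emeasure lborel base * (of_nat DIM('b) * beta_nat (DIM('b) - 1) DIM('a)))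
    \<le> emeasure lborel C"
  unfolding emeasure_eq_fibres nn_integral_cone_weight[symmetric]
  by (subst nn_integral_cmult[symmetric]) (auto intro!: nn_integral_mono cone_weight_fibre)

text \<open>Equality of integrals gives equality of fibre volumes almost everywhere
  (\<open>ae\<close>), then at the given interior point (\<open>le\<close>). The shrunken copy of
  the fibre over 0 inside the fibre over \<open>z\<close> thus has full volume.\<close>

theorem fibres_homothetic_if_section_times_projection_eq:
  assumes eq: "emeasure lborel C \<le>
      emeasure lborel (fibre 0) * (emeasure lborel base * (of_nat DIM('b) * beta_nat (DIM('b) - 1) DIM('a)))"
    and pos: "emeasure lborel (fibre 0) \<noteq> 0"
    and z: "z \<in> interior base"
  shows "\<exists>g s. 0 < s \<and> fibre z = (\<lambda>v. g + s *\<^sub>R v) ` fibre 0"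
proof -
  let ?v = "\<lambda>z. emeasure lborel (fibre z)"
  let ?m = "DIM('b)"
  have zb: "z \<in> base" using z interior_subset by blast
  have fin: "?v w < \<infinity>" for w using emeasure_compact_finite[OF compact_fibre] by auto
  have vm [measurable]: "?v \<in> borel_measurable lborel"
    by (rule lborel.measurable_emeasure_Pair[OF C_measurable])
  have ae: "AE w in lborel. ?v w \<le> ?v 0 * cone_weight w"
  proof (rule ccontr)
    assume "\<not> ?thesis"
    then have "(\<integral>\<^sup>+w. ?v 0 * cone_weight w \<partial>lborel) < (\<integral>\<^sup>+w. ?v w \<partial>lborel)"
    proof (intro nn_integral_less)
      have "(\<integral>\<^sup>+w. ?v 0 * cone_weight w \<partial>lborel) \<le> emeasure lborel C"
        unfolding emeasure_eq_fibres by (intro nn_integral_mono cone_weight_fibre)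
      then show "(\<integral>\<^sup>+w. ?v 0 * cone_weight w \<partial>lborel) \<noteq> \<infinity>"
        using emeasure_compact_finite[OF compact] by (auto simp: top_unique)
    qed (auto intro: cone_weight_fibre)
    then show False using eq
      by (subst (asm) nn_integral_cmult) (auto simp: nn_integral_cone_weight emeasure_eq_fibres)
  qed
  define s where "s = depth z"
  have s01: "0 \<le> s" "s \<le> 1" using depth_range[OF zb] by (auto simp: s_def)
  have "s < 1"
  proof -
    obtain e where e: "0 < e" "cball z e \<subseteq> base" using z by (meson mem_interior_cball)
    \<comment> \<open>Small enough that \<open>(1 + d) *\<^sub>R z\<close> stays in the ball around
      \<open>z\<close>, which gives \<open>depth z\<close> at most
      \<open>1 / (1 + d)\<close>.\<close>
    define d where "d = e / (norm z + 1)"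
    have d: "0 < d" using e by (simp add: d_def add_nonneg_pos)
    have "e * norm z \<le> e * (norm z + 1)" using e by (intro mult_left_mono) auto
    then have "norm z * d \<le> e" using e by (simp add: d_def divide_le_eq add_nonneg_pos mult.commute)
    then have "(1 + d) *\<^sub>R z \<in> cball z e" using d by (simp add: dist_norm algebra_simps)
    then have "(1 + d) *\<^sub>R z \<in> base" using e by blast
    then have "z \<in> (*\<^sub>R) (1 / (1 + d)) ` base" using d by (intro image_eqI[of _ _ "(1 + d) *\<^sub>R z"]) auto
    then have "s \<le> 1 / (1 + d)" using depth_le[OF zb, of "1 / (1 + d)"] d by (simp add: s_def)
    also have "\<dots> < 1" using d by simp
    finally show ?thesis .
  qed
  \<comment> \<open>An excess at \<open>z\<close> spreads to an open set: fibres over points mixed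
    from \<open>z\<close> and a little of the projection lose at most the factor
    \<open>(1 - e) ^ ?m\<close>, while \<open>depth\<close> stays above \<open>s - e\<close> near
    \<open>z\<close>. For small \<open>e\<close> the strict inequality survives both losses, against
    \<open>ae\<close>.\<close>
  have le: "?v z \<le> ennreal ((1 - s) ^ ?m) * ?v 0"
  proof (rule ccontr)
    assume "\<not> ?thesis"
    then have gt: "ennreal ((1 - s) ^ ?m) * ?v 0 < ?v z" by simp
    define a where "a = measure lborel (fibre 0)"
    define c where "c = measure lborel (fibre z)"
    have ac: "?v 0 = ennreal a" "?v z = ennreal c" "0 \<le> a" "0 \<le> c"
      using fin[of 0] fin[of z] by (auto simp: a_def c_def emeasure_eq_ennreal_measure less_top)
    have "(1 - s) ^ ?m * a < c"
      using gt s01 ac by (simp add: ennreal_mult'[symmetric] ennreal_less_iff)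
    have "((\<lambda>e. (1 - e) ^ ?m * c - (1 - s + e) ^ ?m * a) \<longlongrightarrow> (1 - 0) ^ ?m * c - (1 - s + 0) ^ ?m * a) (at_right 0)"
      by (intro tendsto_intros)
    then have "eventually (\<lambda>e. 0 < (1 - e) ^ ?m * c - (1 - s + e) ^ ?m * a) (at_right 0)"
      using \<open>(1 - s) ^ ?m * a < c\<close> by (intro order_tendstoD(1)) auto
    moreover have "eventually (\<lambda>e. e \<in> {0<..<1::real}) (at_right 0)"
      by (rule eventually_at_right_real) simp
    ultimately have "eventually (\<lambda>e. e \<in> {0<..<1} \<and> 0 < (1 - e) ^ ?m * c - (1 - s + e) ^ ?m * a) (at_right 0)"
      by eventually_elim simp
    from eventually_happens'[OF trivial_limit_at_right_real this]
    obtain e where e: "0 < e" "e < 1" "(1 - s + e) ^ ?m * a < (1 - e) ^ ?m * c" by auto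
    define U where "U = (\<lambda>b. (1 - e) *\<^sub>R z + e *\<^sub>R b) ` interior base \<inter>
      - {z. \<exists>r\<in>{0..1}. r \<le> s - e \<and> z \<in> (*\<^sub>R) r ` base}"
    have "open ((\<lambda>b. (1 - e) *\<^sub>R z + e *\<^sub>R b) ` interior base)"
      using open_affinity[OF open_interior, of e "(1 - e) *\<^sub>R z" base] e by simp
    then have "open U" unfolding U_def using closed_sublevel by blast
    moreover have "z \<in> U"
    proof -
      have "z = (1 - e) *\<^sub>R z + e *\<^sub>R z" by (simp add: algebra_simps)
      then have "z \<in> (\<lambda>b. (1 - e) *\<^sub>R z + e *\<^sub>R b) ` interior base" using z by blast
      moreover have "\<not> (\<exists>r\<in>{0..1}. r \<le> s - e \<and> z \<in> (*\<^sub>R) r ` base)"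
      proof
        assume "\<exists>r\<in>{0..1}. r \<le> s - e \<and> z \<in> (*\<^sub>R) r ` base"
        then obtain r where r: "r \<in> {0..1}" "r \<le> s - e" "z \<in> (*\<^sub>R) r ` base" by blast
        then have "s \<le> r" using depth_le[OF zb r(1)] by (simp add: s_def)
        then show False using r e by simp
      qed
      ultimately show ?thesis unfolding U_def by blast
    qed
    ultimately have "\<not> negligible U" using open_not_negligible by blast
    have U: "\<not> ?v w \<le> ?v 0 * cone_weight w" if wU: "w \<in> U" for w
    proof -
      obtain b where b: "b \<in> interior base" "w = (1 - e) *\<^sub>R z + e *\<^sub>R b" using wU unfolding U_def by blast
      have bb: "b \<in> base" using b interior_subset by blast
      have wb: "w \<in> base" unfolding b(2) using e zb bb by (intro convexD[OF convex_base]) auto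
      have "s - e < depth w"
      proof (rule ccontr)
        assume "\<not> s - e < depth w"
        then have "\<exists>r\<in>{0..1}. r \<le> s - e \<and> w \<in> (*\<^sub>R) r ` base"
          using depth_range[OF wb] depth_mem[OF wb] by (intro bexI[of _ "depth w"]) auto
        then show False using wU unfolding U_def by blast
      qed
      then have "(1 - depth w) ^ ?m \<le> (1 - s + e) ^ ?m"
        using depth_range[OF wb] by (intro power_mono) auto
      then have "(1 - depth w) ^ ?m * a < (1 - e) ^ ?m * c"
        using e(3) mult_right_mono[OF _ ac(3)] by fastforce
      then have "?v 0 * cone_weight w < ennreal ((1 - e) ^ ?m) * ?v z"
        using wb depth_range[OF wb] ac e
        by (simp add: cone_weight_eq ennreal_mult''[symmetric] ennreal_mult'[symmetric] ennreal_less_iff mult.commute)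
      also have "\<dots> \<le> ?v w" unfolding b(2) using e bb by (intro emeasure_fibre_shrink) auto
      finally show ?thesis by simp
    qed
    have "AE w in lborel. w \<notin> U" using ae by eventually_elim (use U in blast)
    then have "U \<in> null_sets lborel" using \<open>open U\<close> by (subst AE_iff_null_sets) auto
    then have "negligible U" by (simp add: negligible_iff_null_sets null_sets_completionI)
    then show False using \<open>\<not> negligible U\<close> by blast
  qed
  obtain b where b: "b \<in> base" "z = s *\<^sub>R b" using depth_mem[OF zb] by (auto simp: s_def)
  obtain g where g: "(\<lambda>v. g + (1 - s) *\<^sub>R v) ` fibre 0 \<subseteq> fibre z"
    using fibre_shrink[OF s01 b(1), of 0] b(2) by auto
  have vol: "emeasure lborel ((\<lambda>v. g + (1 - s) *\<^sub>R v) ` fibre 0) = ennreal ((1 - s) ^ ?m) * ?v 0"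
    using s01 by (simp add: emeasure_lborel_affine[OF compact_fibre])
  have "(\<lambda>v. g + (1 - s) *\<^sub>R v) ` fibre 0 = fibre z"
  proof (rule convex_eq_if_emeasure_eq[OF _ g compact_fibre convex_fibre])
    show "compact ((\<lambda>v. g + (1 - s) *\<^sub>R v) ` fibre 0)"
      by (intro compact_continuous_image compact_fibre continuous_intros)
    show "emeasure lborel ((\<lambda>v. g + (1 - s) *\<^sub>R v) ` fibre 0) \<noteq> 0"
      using vol pos \<open>s < 1\<close> by (simp add: ennreal_eq_0_iff not_le)
  qed (use vol le in simp)
  then show ?thesis using \<open>s < 1\<close> by (intro exI[of _ g] exI[of _ "1 - s"]) auto
qed

end

section \<open>The join of the diagonal and the Cartesian power\<close>

lemma enn2real_power: "enn2real (x ^ n) = enn2real x ^ n"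
  by (induction n) (simp_all add: enn2real_mult)

section \<open>Lebesgue measure on Cartesian powers\<close>

lemma measurable_vec_lambda [measurable]:
  "(\<lambda>f. (\<chi> i. f i) :: 'a::euclidean_space ^ 'p) \<in> borel_measurable (\<Pi>\<^sub>M i\<in>UNIV. lborel)"
  by (subst borel_measurable_euclidean_space) (auto simp: Basis_vec_def inner_axis)

text \<open>It suffices to compare boxes. The basis of the power consists of one copy of
  \<open>Basis\<close> per index, so side lengths regroup coordinate by coordinate.\<close>

lemma lborel_vec:
  "(lborel :: ('a::euclidean_space ^ 'p) measure) = distr (\<Pi>\<^sub>M i\<in>UNIV. lborel) borel (\<lambda>f. \<chi> i. f i)"
proof (rule lborel_eqI)
  interpret product_sigma_finite "\<lambda>_::'p. lborel :: 'a measure" ..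
  fix l u :: "'a ^ 'p" assume lu: "\<And>b. b \<in> Basis \<Longrightarrow> l \<bullet> b \<le> u \<bullet> b"
  have lu': "l $ i \<bullet> b \<le> u $ i \<bullet> b" if "b \<in> Basis" for i b
    using lu[of "axis i b"] that by (auto simp: Basis_vec_def inner_axis)
  have Bas: "(Basis :: ('a ^ 'p) set) = (\<lambda>(i, b). axis i b) ` (UNIV \<times> Basis)"
    by (auto simp: Basis_vec_def)
  have inj: "inj_on (\<lambda>(i, b). axis i b) (UNIV \<times> Basis :: ('p \<times> 'a) set)"
    by (auto simp: inj_on_def axis_eq_axis)
  have "(\<lambda>f. \<chi> i. f i) -` box l u \<inter> space (\<Pi>\<^sub>M i\<in>UNIV. lborel) = (\<Pi>\<^sub>E i\<in>UNIV. box (l $ i) (u $ i))"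
    by (auto simp: box_def Bas inner_axis PiE_def space_PiM extensional_def)
  then have "emeasure (distr (\<Pi>\<^sub>M i\<in>UNIV. lborel) borel (\<lambda>f. \<chi> i. f i)) (box l u)
      = emeasure (\<Pi>\<^sub>M i\<in>UNIV. lborel) (\<Pi>\<^sub>E i\<in>UNIV. box (l $ i) (u $ i))"
    by (simp add: emeasure_distr)
  also have "\<dots> = (\<Prod>i\<in>UNIV. emeasure lborel (box (l $ i) (u $ i)))"
    by (intro emeasure_PiM) auto
  also have "\<dots> = (\<Prod>i\<in>UNIV. ennreal (\<Prod>b\<in>Basis. (u $ i - l $ i) \<bullet> b))"
    by (intro prod.cong refl emeasure_lborel_box lu')
  also have "\<dots> = ennreal (\<Prod>i\<in>UNIV. \<Prod>b\<in>Basis. (u $ i - l $ i) \<bullet> b)"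
    using lu' by (intro prod_ennreal prod_nonneg) (simp add: inner_diff_left)
  also have "(\<Prod>i\<in>UNIV. \<Prod>b\<in>Basis. (u $ i - l $ i) \<bullet> b) = (\<Prod>b\<in>Basis. (u - l) \<bullet> b)"
    unfolding Bas by (subst prod.reindex[OF inj]) (simp add: prod.cartesian_product case_prod_unfold inner_axis)
  finally show "emeasure (distr (\<Pi>\<^sub>M i\<in>UNIV. lborel) borel (\<lambda>f. \<chi> i. f i)) (box l u) = (\<Prod>b\<in>Basis. (u - l) \<bullet> b)" .
qed simp

lemma compact_cart_power:
  assumes "compact (K :: 'a::euclidean_space set)"
  shows "compact (cart_power K :: ('a ^ 'p) set)"
proof -
  have "closed (cart_power K :: ('a ^ 'p) set)"
    unfolding cart_power_def using assms closed_vector_box[of "\<lambda>_. K"] by (auto simp: compact_imp_closed)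
  moreover obtain B where B: "\<forall>x\<in>K. norm x \<le> B"
    using compact_imp_bounded[OF assms] unfolding bounded_iff by blast
  have "norm x \<le> (\<Sum>i\<in>(UNIV::'p set). B)" if "x \<in> cart_power K" for x :: "'a ^ 'p"
    using that B unfolding norm_vec_def cart_power_def
    by (intro order_trans[OF L2_set_le_sum] sum_mono) auto
  then have "bounded (cart_power K :: ('a ^ 'p) set)" unfolding bounded_iff by blast
  ultimately show ?thesis by (simp add: compact_eq_bounded_closed)
qed

lemma convex_cart_power: "convex K \<Longrightarrow> convex (cart_power K)"
  by (simp add: convex_def cart_power_def)

lemma emeasure_cart_power:
  assumes "compact (K :: 'a::euclidean_space set)"
  shows "emeasure lborel (cart_power K :: ('a ^ 'p) set) = emeasure lborel K ^ CARD('p)"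
proof -
  interpret product_sigma_finite "\<lambda>_::'p. lborel :: 'a measure" ..
  have "(\<lambda>f. \<chi> i. f i) -` cart_power K \<inter> space (\<Pi>\<^sub>M i\<in>UNIV. lborel) = (\<Pi>\<^sub>E i\<in>(UNIV::'p set). K)"
    by (auto simp: cart_power_def PiE_def space_PiM extensional_def)
  note pre = this
  have "emeasure lborel (cart_power K :: ('a ^ 'p) set)
      = emeasure (distr (\<Pi>\<^sub>M i\<in>UNIV. lborel) borel (\<lambda>f. \<chi> i. f i)) (cart_power K :: ('a ^ 'p) set)"
    by (simp only: lborel_vec)
  also have "\<dots> = emeasure (\<Pi>\<^sub>M i\<in>UNIV. lborel) (\<Pi>\<^sub>E i\<in>(UNIV::'p set). K)"
    by (subst emeasure_distr[OF measurable_vec_lambda borel_compact[OF compact_cart_power[OF assms]]])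
      (simp only: pre)
  also have "\<dots> = (\<Prod>i\<in>(UNIV::'p set). emeasure lborel K)"
    using borel_compact[OF assms] by (intro emeasure_PiM) auto
  finally show ?thesis by simp
qed

lemma continuous_on_diag [continuous_intros]:
  "continuous_on S f \<Longrightarrow> continuous_on S (\<lambda>x. diag (f x) :: 'a::topological_space ^ 'p)"
  unfolding diag_def by (intro continuous_intros)

lemma diag_add: "diag (x + y) = (diag x + diag y :: 'a::real_vector ^ 'p)"
  and diag_scaleR: "diag (r *\<^sub>R x) = (r *\<^sub>R diag x :: 'a::real_vector ^ 'p)"
  and diag_zero [simp]: "diag 0 = (0 :: 'a::real_vector ^ 'p)"
  by (simp_all add: diag_def vec_eq_iff)

lemma diag_mem_scaled_cart_power:
  "(diag z :: 'a::real_vector ^ 'p) \<in> (*\<^sub>R) r ` cart_power K \<longleftrightarrow> z \<in> (*\<^sub>R) r ` K"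
proof
  assume "(diag z :: 'a ^ 'p) \<in> (*\<^sub>R) r ` cart_power K"
  then obtain y :: "'a ^ 'p" where "diag z = r *\<^sub>R y" "\<forall>i. y $ i \<in> K" by (auto simp: cart_power_def)
  then show "z \<in> (*\<^sub>R) r ` K"
    \<comment> \<open>Any coordinate serves as witness; \<open>undefined\<close> is merely some
      index.\<close>
    by (intro image_eqI[of _ _ "y $ undefined"]) (auto simp: diag_def vec_eq_iff)
next
  assume "z \<in> (*\<^sub>R) r ` K"
  then obtain k where "z = r *\<^sub>R k" "k \<in> K" by blast
  then show "(diag z :: 'a ^ 'p) \<in> (*\<^sub>R) r ` cart_power K"
    by (intro image_eqI[of _ _ "diag k"]) (auto simp: diag_scaleR cart_power_def, simp add: diag_def)
qed

lemma emeasure_scaled_Int: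
  assumes "compact (K :: 'a::euclidean_space set)" "convex K" "0 \<in> K" "0 \<le> a" "0 \<le> b"
  shows "emeasure lborel ((*\<^sub>R) a ` K \<inter> (*\<^sub>R) b ` K) = ennreal (min a b ^ DIM('a)) * emeasure lborel K"
proof -
  have "(*\<^sub>R) a ` K \<inter> (*\<^sub>R) b ` K = (*\<^sub>R) (min a b) ` K"
    using scaled_mono[OF assms(2,3), of a b] scaled_mono[OF assms(2,3), of b a] assms(4,5)
    by (cases "a \<le> b") (auto simp: min_def)
  then show ?thesis using assms by (simp add: emeasure_lborel_scaled)
qed

section \<open>Beta integrals and the double cone\<close>

lemma beta_nat_pos: "beta_nat k d \<noteq> 0"
proof
  assume "beta_nat k d = 0"
  then have "AE r in lborel. ennreal ((1 - r) ^ k * r ^ d) * indicator {0..1} r = 0"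
    unfolding beta_nat_def by (subst (asm) nn_integral_0_iff_AE) auto
  then have "AE r::real in lborel. r \<notin> {0<..<1}"
  proof eventually_elim
    case (elim r)
    show ?case
    proof
      assume r: "r \<in> {0<..<1}"
      then have "0 < (1 - r) ^ k * r ^ d" by simp
      moreover have "(1 - r) ^ k * r ^ d \<le> 0" using elim r by (simp add: ennreal_eq_0_iff)
      ultimately show False by simp
    qed
  qed
  then have "{0<..<1::real} \<in> null_sets lborel" by (subst AE_iff_null_sets) auto
  then show False by (simp add: null_sets_def)
qed

lemma beta_nat_finite: "beta_nat k d \<noteq> top"
proof -
  have "beta_nat k d \<le> (\<integral>\<^sup>+r. indicator {0..1::real} r \<partial>lborel)"
    unfolding beta_nat_def
    by (intro nn_integral_mono) (auto simp: indicator_def intro!: mult_le_one power_le_one)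
  also have "\<dots> = 1" by simp
  finally show ?thesis by (auto simp: top_unique)
qed

text \<open>The two terms of the minimum cross at r = t with value 1 - t. The integral is that of
  two cones of heights t and 1 - t over a common cross-section of scale 1 - t.\<close>

lemma nn_integral_min_power:
  assumes t: "0 < t" "t < 1"
  shows "(\<integral>\<^sup>+r. ennreal (min (1 - r) ((1 - t) / t * r) ^ n) * indicator {0..1} r \<partial>lborel)
    = ennreal ((1 - t) ^ n / (n + 1))"
proof -
  let ?c = "(1 - t) / t"
  have le: "?c * r \<le> 1 - r \<longleftrightarrow> r \<le> t" for r using t by (simp add: field_simps)
  have "(\<integral>\<^sup>+r. ennreal (min (1 - r) (?c * r) ^ n) * indicator {0..1} r \<partial>lborel)
      = (\<integral>\<^sup>+r. (ennreal ((?c * r) ^ n) * indicator {0..t} r + ennreal ((1 - r) ^ n) * indicator {t..1} r) \<partial>lborel)"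
  proof (rule nn_integral_cong_AE)
    \<comment> \<open>The two closed intervals overlap in t, so the integrands are compared off this
      point.\<close>
    have "AE r in lborel. r \<noteq> t" by (rule AE_lborel_singleton)
    then show "AE r in lborel. ennreal (min (1 - r) (?c * r) ^ n) * indicator {0..1} r
      = ennreal ((?c * r) ^ n) * indicator {0..t} r + ennreal ((1 - r) ^ n) * indicator {t..1} r"
    proof eventually_elim
      case (elim r)
      then consider "r < t" | "t < r" by linarith
      then show ?case
      proof cases
        case 1
        then have "min (1 - r) (?c * r) = ?c * r" using le[of r] by (simp add: min_def)
        then show ?thesis using 1 t by (simp add: indicator_def)
      next
        case 2
        then have "min (1 - r) (?c * r) = 1 - r" using le[of r] by (simp add: min_def)
        then show ?thesis using 2 t by (simp add: indicator_def)
      qed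
    qed
  qed
  also have "\<dots> = (\<integral>\<^sup>+r. ennreal ((?c * r) ^ n) * indicator {0..t} r \<partial>lborel)
      + (\<integral>\<^sup>+r. ennreal ((1 - r) ^ n) * indicator {t..1} r \<partial>lborel)"
    by (rule nn_integral_add) measurable
  also have "(\<integral>\<^sup>+r. ennreal ((?c * r) ^ n) * indicator {0..t} r \<partial>lborel)
      = ennreal (?c ^ n * t ^ (n + 1) / (n + 1) - ?c ^ n * 0 ^ (n + 1) / (n + 1))"
  proof (intro nn_integral_FTC_Icc)
    fix r
    have "((\<lambda>r. ?c ^ n * r ^ (n + 1) / real (n + 1)) has_real_derivative ?c ^ n * (real (n + 1) * r ^ n) / real (n + 1)) (at r)"
      by (rule DERIV_cdivide, rule DERIV_cmult) (use DERIV_pow[of "n + 1" r] in simp)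
    then show "((\<lambda>r. ?c ^ n * r ^ (n + 1) / real (n + 1)) has_real_derivative (?c * r) ^ n) (at r)"
      by (simp only: power_mult_distrib nonzero_mult_div_cancel_left times_divide_eq_right[symmetric]) simp
  qed (use t in auto)
  also have "?c ^ n * t ^ (n + 1) / (n + 1) - ?c ^ n * 0 ^ (n + 1) / (n + 1) = t * (1 - t) ^ n / (n + 1)"
    using t by (simp add: power_divide)
  also have "(\<integral>\<^sup>+r. ennreal ((1 - r) ^ n) * indicator {t..1} r \<partial>lborel)
      = ennreal (- ((1 - 1) ^ (n + 1) / (n + 1)) - (- ((1 - t) ^ (n + 1) / (n + 1))))"
  proof (intro nn_integral_FTC_Icc)
    fix r
    have "((\<lambda>r. (1 - r) ^ Suc n) has_real_derivative (1 + real n) * (- 1 * (1 - r) ^ n)) (at r)"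
      by (rule DERIV_power_Suc) (auto intro!: derivative_eq_intros)
    from DERIV_minus[OF DERIV_cdivide[OF this, of "1 + real n"]]
    show "((\<lambda>r. - ((1 - r) ^ (n + 1) / real (n + 1))) has_real_derivative (1 - r) ^ n) (at r)"
      by simp
  qed (use t in auto)
  also have "- ((1 - 1) ^ (n + 1) / (n + 1)) - (- ((1 - t) ^ (n + 1) / (n + 1))) = (1 - t) * (1 - t) ^ n / (n + 1)"
    by simp
  also have "ennreal (t * (1 - t) ^ n / (n + 1)) + ennreal ((1 - t) * (1 - t) ^ n / (n + 1)) = ennreal ((1 - t) ^ n / (n + 1))"
    using t by (subst ennreal_plus[symmetric]) (auto simp: add_divide_distrib[symmetric] algebra_simps)
  finally show ?thesis .
qed

section \<open>The lifted body and its volume\<close>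

definition join_lift :: "real \<Rightarrow> 'a::euclidean_space set \<Rightarrow> (('a ^ 'p) \<times> ('a \<times> real)) set" where
  "join_lift t K = {(z, x, \<theta>). \<theta> \<in> {0..1} \<and> x \<in> (*\<^sub>R) (1 - \<theta>) ` K \<and>
     z + t *\<^sub>R diag x \<in> (*\<^sub>R) ((1 - t) * \<theta>) ` cart_power K}"

definition diag_join :: "real \<Rightarrow> 'a::euclidean_space set \<Rightarrow> ('a ^ 'p) set" where
  "diag_join t K = (\<lambda>x. (- t) *\<^sub>R diag x) ` K \<squnion>\<^sub>c (\<lambda>y. (1 - t) *\<^sub>R y) ` cart_power K"

locale body_at_zero =
  fixes K :: "'a::euclidean_space set"
  assumes body: "convex_body K" and zero: "0 \<in> K"
begin

lemma cpt: "compact K" and cvx: "convex K" using body by (simp_all add: convex_body_def)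

lemma meas [measurable]: "K \<in> sets borel" using cpt by (rule borel_compact)

lemma zero_cart_power: "0 \<in> cart_power K" using zero by (simp add: cart_power_def)

text \<open>Compactness and the projection are read off this parametrisation by a point of
  \<open>K\<close>, a point of its power and the weight of the latter. It is not affine, so
  convexity is proved from the defining conditions, where \<open>x\<close> is already scaled by 1 -
  \<theta>.\<close>

lemma join_lift_image:
  "(join_lift t K :: (('a ^ 'p) \<times> 'a \<times> real) set) =
    (\<lambda>(k, y, \<theta>). (((1 - t) * \<theta>) *\<^sub>R y - (t * (1 - \<theta>)) *\<^sub>R diag k, (1 - \<theta>) *\<^sub>R k, \<theta>)) ` (K \<times> cart_power K \<times> {0..1})"
proof (intro set_eqI iffI)
  fix v :: "('a ^ 'p) \<times> 'a \<times> real" assume v: "v \<in> join_lift t K"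
  obtain z x th where [simp]: "v = (z, x, th)" by (cases v)
  from v obtain k y where ky: "th \<in> {0..1}" "k \<in> K" "x = (1 - th) *\<^sub>R k" "y \<in> cart_power K"
    "z + t *\<^sub>R diag x = ((1 - t) * th) *\<^sub>R y" unfolding join_lift_def by auto
  then have "z = ((1 - t) * th) *\<^sub>R y - (t * (1 - th)) *\<^sub>R diag k"
    by (simp add: diag_scaleR eq_diff_eq)
  then show "v \<in> (\<lambda>(k, y, \<theta>). (((1 - t) * \<theta>) *\<^sub>R y - (t * (1 - \<theta>)) *\<^sub>R diag k, (1 - \<theta>) *\<^sub>R k, \<theta>)) ` (K \<times> cart_power K \<times> {0..1})"
    using ky by (intro image_eqI[of _ _ "(k, y, th)"]) auto
qed (auto simp: join_lift_def diag_scaleR)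

lemma compact_join_lift: "compact (join_lift t K :: (('a ^ 'p) \<times> 'a \<times> real) set)"
  unfolding join_lift_image case_prod_unfold
  by (intro compact_continuous_image compact_Times cpt compact_cart_power continuous_intros compact_Icc)

lemma convex_join_lift:
  assumes t: "t \<in> {0..1}"
  shows "convex (join_lift t K :: (('a ^ 'p) \<times> 'a \<times> real) set)"
proof (rule convexI)
  fix v w :: "('a ^ 'p) \<times> 'a \<times> real" and a b :: real
  assume *: "v \<in> join_lift t K" "w \<in> join_lift t K" "0 \<le> a" "0 \<le> b" "a + b = 1"
  obtain z x th where v: "v = (z, x, th)" by (cases v)
  obtain z' x' th' where w: "w = (z', x', th')" by (cases w)
  have v': "th \<in> {0..1}" "x \<in> (*\<^sub>R) (1 - th) ` K" "z + t *\<^sub>R diag x \<in> (*\<^sub>R) ((1 - t) * th) ` cart_power K"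
    and w': "th' \<in> {0..1}" "x' \<in> (*\<^sub>R) (1 - th') ` K" "z' + t *\<^sub>R diag x' \<in> (*\<^sub>R) ((1 - t) * th') ` cart_power K"
    using * v w by (auto simp: join_lift_def)
  have "a * th + b * th' \<le> a * 1 + b * 1" using v' w' * by (intro add_mono mult_left_mono) auto
  then have 1: "a * th + b * th' \<in> {0..1}" using v' w' * by auto
  have "a *\<^sub>R x + b *\<^sub>R x' \<in> (*\<^sub>R) (a * (1 - th) + b * (1 - th')) ` K"
    using v' w' * by (intro scaled_sum_mem[OF cvx] scaled_scaled) auto
  moreover have "a * (1 - th) + b * (1 - th') = 1 - (a * th + b * th')"
    using *(5) by (simp add: algebra_simps)
  ultimately have 2: "a *\<^sub>R x + b *\<^sub>R x' \<in> (*\<^sub>R) (1 - (a * th + b * th')) ` K" by simp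
  have "a *\<^sub>R (z + t *\<^sub>R diag x) + b *\<^sub>R (z' + t *\<^sub>R diag x')
      \<in> (*\<^sub>R) (a * ((1 - t) * th) + b * ((1 - t) * th')) ` cart_power K"
    using v' w' * t by (intro scaled_sum_mem[OF convex_cart_power[OF cvx]] scaled_scaled) auto
  moreover have "a *\<^sub>R (z + t *\<^sub>R diag x) + b *\<^sub>R (z' + t *\<^sub>R diag x')
      = a *\<^sub>R z + b *\<^sub>R z' + t *\<^sub>R diag (a *\<^sub>R x + b *\<^sub>R x')"
    by (simp add: diag_add diag_scaleR algebra_simps)
  moreover have "a * ((1 - t) * th) + b * ((1 - t) * th') = (1 - t) * (a * th + b * th')"
    by (simp add: algebra_simps)
  ultimately show "a *\<^sub>R v + b *\<^sub>R w \<in> join_lift t K"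
    using 1 2 by (simp add: join_lift_def v w)
qed

lemma fst_join_lift: "fst ` join_lift t K = (diag_join t K :: ('a ^ 'p) set)"
proof -
  let ?A = "(\<lambda>x. (- t) *\<^sub>R (diag x :: 'a ^ 'p)) ` K" and ?B = "(\<lambda>y. (1 - t) *\<^sub>R y) ` (cart_power K :: ('a ^ 'p) set)"
  have "linear (\<lambda>x. (- t) *\<^sub>R (diag x :: 'a ^ 'p))"
    by (intro linearI) (auto simp: diag_add diag_scaleR algebra_simps)
  then have "convex ?A" using cvx by (rule convex_linear_image)
  moreover have "convex ?B" using convex_cart_power[OF cvx] by (rule convex_scaling)
  ultimately have "diag_join t K = {u *\<^sub>R a + v *\<^sub>R b | u v a b. u \<ge> 0 \<and> v \<ge> 0 \<and> u + v = 1 \<and> a \<in> ?A \<and> b \<in> ?B}"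
    unfolding diag_join_def join_def using zero zero_cart_power by (intro convex_hull_union_two) blast+
  also have "\<dots> = fst ` join_lift t K"
  proof (intro set_eqI iffI)
    fix z assume "z \<in> {u *\<^sub>R a + v *\<^sub>R b | u v a b. u \<ge> 0 \<and> v \<ge> 0 \<and> u + v = 1 \<and> a \<in> ?A \<and> b \<in> ?B}"
    then obtain u v k y where *: "u \<ge> 0" "v \<ge> 0" "u + v = 1" "k \<in> K" "y \<in> cart_power K"
      "z = u *\<^sub>R ((- t) *\<^sub>R diag k) + v *\<^sub>R ((1 - t) *\<^sub>R y)" by blast
    have u: "u = 1 - v" using * by simp
    have "fst (((1 - t) * v) *\<^sub>R y - (t * (1 - v)) *\<^sub>R diag k, (1 - v) *\<^sub>R k, v) = z"
      unfolding *(6) u by (simp add: mult.commute)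
    then show "z \<in> fst ` join_lift t K" unfolding join_lift_image image_image
      using * by (intro image_eqI[of _ _ "(k, y, v)"]) auto
  next
    fix z :: "'a ^ 'p" assume "z \<in> fst ` join_lift t K"
    then obtain k y v where *: "k \<in> K" "y \<in> cart_power K" "v \<in> {0..1}"
      "z = ((1 - t) * v) *\<^sub>R y - (t * (1 - v)) *\<^sub>R diag k" unfolding join_lift_image by auto
    then have "z = (1 - v) *\<^sub>R ((- t) *\<^sub>R diag k) + v *\<^sub>R ((1 - t) *\<^sub>R y)"
      by (simp add: mult.commute)
    moreover have "(- t) *\<^sub>R diag k \<in> ?A" "(1 - t) *\<^sub>R y \<in> ?B" using * by auto
    moreover have "0 \<le> 1 - v" "0 \<le> v" "1 - v + v = 1" using * by auto
    ultimately show "z \<in> {u *\<^sub>R a + v *\<^sub>R b | u v a b. u \<ge> 0 \<and> v \<ge> 0 \<and> u + v = 1 \<and> a \<in> ?A \<and> b \<in> ?B}" by blast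
  qed
  finally show ?thesis ..
qed

lemma fibred: "t \<in> {0..1} \<Longrightarrow> fibred_body (join_lift t K :: (('a ^ 'p) \<times> 'a \<times> real) set)"
proof
  have "(0, 0, 0) \<in> (join_lift t K :: (('a ^ 'p) \<times> 'a \<times> real) set)"
    using zero zero_cart_power unfolding join_lift_def by (auto intro!: image_eqI[of _ _ 0])
  then show "Pair 0 -` (join_lift t K :: (('a ^ 'p) \<times> 'a \<times> real) set) \<noteq> {}" by blast
qed (auto intro: compact_join_lift convex_join_lift)

text \<open>Over a diagonal point the conditions in all coordinates coincide, so the fibre does not
  depend on the exponent. Dividing by t produces the ratio (1 - t) / t.\<close>

lemma join_lift_fibre:
  assumes "0 < t"
  shows "Pair (diag (t *\<^sub>R y)) -` (join_lift t K :: (('a ^ 'p) \<times> 'a \<times> real) set) = cone_fibre ((1 - t) / t) K y"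
proof -
  have "(diag (t *\<^sub>R y) + t *\<^sub>R diag x :: 'a ^ 'p) \<in> (*\<^sub>R) ((1 - t) * th) ` cart_power K
      \<longleftrightarrow> x + y \<in> (*\<^sub>R) ((1 - t) / t * th) ` K" for x th
  proof -
    have 1: "(diag (t *\<^sub>R y) + t *\<^sub>R diag x :: 'a ^ 'p) = diag (t *\<^sub>R (x + y))"
      by (simp add: diag_add diag_scaleR algebra_simps)
    have 2: "(1 - t) * th = t * ((1 - t) / t * th)" using assms by simp
    show ?thesis unfolding 1 diag_mem_scaled_cart_power unfolding 2
      using assms by (intro scaled_scaled_iff) simp
  qed
  then show ?thesis unfolding join_lift_def cone_fibre_def by auto
qed

text \<open>Both cones over y = 0 have multiples of \<open>K\<close> as slices, and two such
  multiples are nested because \<open>0 \<in> K\<close>; the smaller factor decides.\<close>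

lemma emeasure_cone_fibre:
  assumes t: "0 < t" "t < 1"
  shows "emeasure lborel (cone_fibre ((1 - t) / t) K 0) = ennreal ((1 - t) ^ DIM('a) / (DIM('a) + 1)) * emeasure lborel K"
proof -
  let ?c = "(1 - t) / t"
  \<comment> \<open>As the fibre is the same for every exponent, its compactness may be taken from
    exponent 1.\<close>
  interpret F: fibred_body "join_lift t K :: (('a ^ 1) \<times> 'a \<times> real) set" using t by (intro fibred) auto
  have "compact (cone_fibre ?c K 0)"
    using F.compact_fibre[of "diag (t *\<^sub>R 0)"] join_lift_fibre[OF t(1), where 'p=1, of 0] by simp
  then have "cone_fibre ?c K 0 \<in> sets (lborel \<Otimes>\<^sub>M lborel)"
    unfolding lborel_prod by (simp add: borel_compact)
  from lborel_pair.emeasure_pair_measure_alt2[OF this]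
  have "emeasure lborel (cone_fibre ?c K 0) = (\<integral>\<^sup>+r. emeasure lborel ((\<lambda>x. (x, r)) -` cone_fibre ?c K 0) \<partial>lborel)"
    by (simp add: lborel_prod)
  also have "\<dots> = (\<integral>\<^sup>+r. ennreal (min (1 - r) (?c * r) ^ DIM('a)) * indicator {0..1} r * emeasure lborel K \<partial>lborel)"
  proof (intro nn_integral_cong)
    fix r :: real
    show "emeasure lborel ((\<lambda>x. (x, r)) -` cone_fibre ?c K 0)
        = ennreal (min (1 - r) (?c * r) ^ DIM('a)) * indicator {0..1} r * emeasure lborel K"
    proof (cases "r \<in> {0..1}")
      case True
      then have "(\<lambda>x. (x, r)) -` cone_fibre ?c K 0 = (*\<^sub>R) (1 - r) ` K \<inter> (*\<^sub>R) (?c * r) ` K"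
        by (auto simp: cone_fibre_def)
      then show ?thesis using True t by (simp add: emeasure_scaled_Int[OF cpt cvx zero])
    next
      case False
      then have "(\<lambda>x. (x, r)) -` cone_fibre ?c K 0 = {}" by (auto simp: cone_fibre_def)
      then show ?thesis using False by simp
    qed
  qed
  also have "\<dots> = ennreal ((1 - t) ^ DIM('a) / (DIM('a) + 1)) * emeasure lborel K"
    by (subst nn_integral_multc) (simp_all only: nn_integral_min_power[OF t], measurable)
  finally show ?thesis .
qed

text \<open>For fixed (x, \<theta>) the slice is a translate of the power of \<open>K\<close> scaled
  by (1 - t) \<theta>, and the admissible x at height \<theta> fill (1 - \<theta>) K.\<close>

lemma emeasure_join_lift:
  assumes t: "t \<in> {0..1}"
  shows "emeasure lborel (join_lift t K :: (('a ^ 'p) \<times> 'a \<times> real) set)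
    = ennreal ((1 - t) ^ (CARD('p) * DIM('a))) * emeasure lborel K ^ (CARD('p) + 1) * beta_nat DIM('a) (CARD('p) * DIM('a))"
proof -
  let ?C = "join_lift t K :: (('a ^ 'p) \<times> 'a \<times> real) set"
  let ?d = "CARD('p) * DIM('a)"
  let ?k = "emeasure lborel K"
  interpret F: fibred_body ?C by (rule fibred[OF t])
  define D where "D = {(x, \<theta>). \<theta> \<in> {0..1} \<and> x \<in> (*\<^sub>R) (1 - \<theta>) ` K}"
  have "D = (\<lambda>(k, \<theta>). ((1 - \<theta>) *\<^sub>R k, \<theta>)) ` (K \<times> {0..1})"
    unfolding D_def by force
  moreover have "compact ((\<lambda>(k, \<theta>). ((1 - \<theta>) *\<^sub>R k, \<theta>)) ` (K \<times> {0..1::real}))"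
    unfolding case_prod_unfold by (intro compact_continuous_image compact_Times cpt compact_Icc continuous_intros)
  ultimately have D [measurable]: "D \<in> sets (lborel \<Otimes>\<^sub>M lborel)" unfolding lborel_prod by (simp add: borel_compact)
  have sec: "emeasure lborel ((\<lambda>z. (z, v)) -` ?C) = ennreal (((1 - t) * snd v) ^ ?d) * ?k ^ CARD('p) * indicator D v" for v
  proof -
    obtain x th where v: "v = (x, th)" by (cases v)
    show ?thesis
    proof (cases "v \<in> D")
      case True
      have "(\<lambda>z. (z, v)) -` ?C = (\<lambda>y. - (t *\<^sub>R diag x) + ((1 - t) * th) *\<^sub>R y) ` cart_power K"
      proof (intro set_eqI iffI)
        fix z assume "z \<in> (\<lambda>z. (z, v)) -` ?C"
        then obtain y where "y \<in> cart_power K" "z + t *\<^sub>R diag x = ((1 - t) * th) *\<^sub>R y"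
          by (auto simp: join_lift_def v)
        then show "z \<in> (\<lambda>y. - (t *\<^sub>R diag x) + ((1 - t) * th) *\<^sub>R y) ` cart_power K"
          by (intro image_eqI[of _ _ y]) (auto simp: algebra_simps)
      qed (use True v in \<open>auto simp: join_lift_def D_def\<close>)
      then have "emeasure lborel ((\<lambda>z. (z, v)) -` ?C) = ennreal (\<bar>(1 - t) * th\<bar> ^ DIM('a ^ 'p)) * ?k ^ CARD('p)"
        by (simp only: emeasure_lborel_affine[OF compact_cart_power[OF cpt]] emeasure_cart_power[OF cpt])
      then show ?thesis using True v t by (simp add: D_def)
    next
      case False
      then have "(\<lambda>z. (z, v)) -` ?C = {}" by (auto simp: join_lift_def D_def v)
      then show ?thesis using False by simp
    qed
  qed
  have "emeasure lborel ?C = (\<integral>\<^sup>+v. emeasure lborel ((\<lambda>z. (z, v)) -` ?C) \<partial>lborel)"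
    using lborel_pair.emeasure_pair_measure_alt2[OF F.C_measurable] by (simp add: lborel_prod)
  also have "\<dots> = (\<integral>\<^sup>+v. ennreal (((1 - t) * snd v) ^ ?d) * ?k ^ CARD('p) * indicator D v \<partial>(lborel \<Otimes>\<^sub>M lborel))"
    by (simp only: sec lborel_prod)
  also have "\<dots> = (\<integral>\<^sup>+r. \<integral>\<^sup>+x. ennreal (((1 - t) * snd (x, r)) ^ ?d) * ?k ^ CARD('p) * indicator D (x, r) \<partial>lborel \<partial>lborel)"
    by (rule lborel_pair.nn_integral_snd[symmetric]) measurable
  also have "\<dots> = (\<integral>\<^sup>+r. (ennreal ((1 - t) ^ ?d) * ?k ^ (CARD('p) + 1)) * (ennreal ((1 - r) ^ DIM('a) * r ^ ?d) * indicator {0..1} r) \<partial>lborel)"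
  proof (intro nn_integral_cong)
    fix r :: real
    show "(\<integral>\<^sup>+x. ennreal (((1 - t) * snd (x, r)) ^ ?d) * ?k ^ CARD('p) * indicator D (x, r) \<partial>lborel)
      = (ennreal ((1 - t) ^ ?d) * ?k ^ (CARD('p) + 1)) * (ennreal ((1 - r) ^ DIM('a) * r ^ ?d) * indicator {0..1} r)"
    proof (cases "r \<in> {0..1}")
      case True
      have meas: "(*\<^sub>R) (1 - r) ` K \<in> sets lborel"
        using compact_scaling[OF cpt, of "1 - r"] by (auto intro: borel_compact)
      have "(\<integral>\<^sup>+x. ennreal (((1 - t) * snd (x, r)) ^ ?d) * ?k ^ CARD('p) * indicator D (x, r) \<partial>lborel)
        = (\<integral>\<^sup>+x. ennreal (((1 - t) * r) ^ ?d) * ?k ^ CARD('p) * indicator ((*\<^sub>R) (1 - r) ` K) x \<partial>lborel)"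
        using True by (intro nn_integral_cong) (auto simp: D_def indicator_def)
      also have "\<dots> = ennreal (((1 - t) * r) ^ ?d) * ?k ^ CARD('p) * (ennreal ((1 - r) ^ DIM('a)) * ?k)"
        using True by (simp only: nn_integral_cmult_indicator[OF meas]) (simp add: emeasure_lborel_scaled[OF cpt])
      finally show ?thesis using True t by (simp add: power_mult_distrib ennreal_mult' mult_ac)
    qed (auto simp: D_def)
  qed
  also have "\<dots> = ennreal ((1 - t) ^ ?d) * ?k ^ (CARD('p) + 1) * beta_nat DIM('a) ?d"
    unfolding beta_nat_def by (subst nn_integral_cmult, measurable)
  finally show ?thesis .
qed


lemma compact_diag_join: "compact (diag_join t K :: ('a ^ 'p) set)"
  unfolding fst_join_lift[symmetric]
  by (intro compact_continuous_image compact_join_lift continuous_intros)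

lemma meas_diag_join: "(diag_join t K :: ('a ^ 'p) set) \<in> sets borel"
  by (intro borel_compact compact_diag_join)

text \<open>For y interior to \<open>K\<close>, 0 divides the segment from
  \<open>(- t) *\<^sub>R diag y\<close> to \<open>(1 - t) *\<^sub>R diag y\<close>, whose second end
  is interior to the join.\<close>

lemma zero_in_interior_diag_join:
  assumes t: "0 < t" "t < 1" and "interior K \<noteq> {}"
  shows "0 \<in> interior (diag_join t K :: ('a ^ 'p) set)"
proof -
  let ?M = "diag_join t K :: ('a ^ 'p) set"
  obtain y where y: "y \<in> interior K" using assms by blast
  have "open (cart_power (interior K) :: ('a ^ 'p) set)"
    unfolding cart_power_def by (rule open_vector_box) simp
  then have "open ((\<lambda>z. 0 + (1 - t) *\<^sub>R z) ` (cart_power (interior K) :: ('a ^ 'p) set))"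
    using t by (intro open_affinity) auto
  moreover have "(\<lambda>z. 0 + (1 - t) *\<^sub>R z) ` cart_power (interior K) \<subseteq> ?M"
  proof -
    have "cart_power (interior K) \<subseteq> cart_power K" using interior_subset by (auto simp: cart_power_def)
    then have "(\<lambda>z. 0 + (1 - t) *\<^sub>R z) ` cart_power (interior K)
        \<subseteq> (\<lambda>x. (- t) *\<^sub>R diag x) ` K \<union> (\<lambda>y. (1 - t) *\<^sub>R y) ` cart_power K" by auto
    then show ?thesis unfolding diag_join_def join_def by (rule order_trans[OF _ hull_subset])
  qed
  moreover have "(1 - t) *\<^sub>R diag y \<in> (\<lambda>z. 0 + (1 - t) *\<^sub>R z) ` (cart_power (interior K) :: ('a ^ 'p) set)"
    using y by (intro image_eqI[of _ _ "diag y"]) (auto simp: cart_power_def diag_def)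
  ultimately have int: "(1 - t) *\<^sub>R diag y \<in> interior ?M" by (meson interior_maximal subsetD)
  have "(- t) *\<^sub>R diag y \<in> ?M"
    using y interior_subset unfolding diag_join_def join_def by (intro hull_inc) blast
  moreover have "convex ?M" unfolding diag_join_def join_def by (rule convex_convex_hull)
  ultimately have "(- t) *\<^sub>R diag y - t *\<^sub>R ((- t) *\<^sub>R diag y - (1 - t) *\<^sub>R diag y) \<in> interior ?M"
    using int t by (intro mem_interior_convex_shrink) auto
  then show ?thesis by (simp add: algebra_simps)
qed

section \<open>The boundary values of t and bodies without interior\<close>

lemma diag_join_subset_hyperplane:
  fixes a :: "'a ^ 'p"
  assumes "\<And>x. x \<in> K \<Longrightarrow> t * (a \<bullet> diag x) = 0"
    and "\<And>y. y \<in> cart_power K \<Longrightarrow> (1 - t) * (a \<bullet> y) = 0"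
  shows "diag_join t K \<subseteq> {z. a \<bullet> z = 0}"
  unfolding diag_join_def join_def
  using assms by (intro hull_minimal convex_hyperplane) auto

lemma measure_diag_join_0: "measure lebesgue (diag_join 0 K :: ('a ^ 'p) set) = measure lebesgue K ^ CARD('p)"
proof -
  have "(\<lambda>x. (- 0) *\<^sub>R (diag x :: 'a ^ 'p)) ` K \<union> (\<lambda>y. (1 - 0) *\<^sub>R y) ` cart_power K = cart_power K"
    using zero zero_cart_power by auto
  then have "diag_join 0 K = (cart_power K :: ('a ^ 'p) set)"
    unfolding diag_join_def join_def by (simp only: hull_same[of convex, OF convex_cart_power[OF cvx]])
  moreover have "(cart_power K :: ('a ^ 'p) set) \<in> sets lborel"
    using borel_compact[OF compact_cart_power[OF cpt]] by simp
  ultimately show ?thesis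
    by (simp add: measure_def emeasure_cart_power[OF cpt] enn2real_power)
qed

text \<open>With one factor the exponent is 0, \<open>0 ^ 0 = 1\<close>, and the join is the
  reflected power. With more factors the join lies in the diagonal, hence in a hyperplane that
  equates one component of two different factors.\<close>

lemma measure_diag_join_1:
  "measure lebesgue (diag_join 1 K :: ('a ^ 'p) set) \<le> 0 ^ (DIM('a) * (CARD('p) - 1)) * measure lebesgue K ^ CARD('p)"
proof (cases "CARD('p) = 1")
  case True
  then obtain i0 :: 'p where i0: "UNIV = {i0}" by (auto simp: card_1_singleton_iff)
  have eq: "(\<lambda>x. (- 1) *\<^sub>R (diag x :: 'a ^ 'p)) ` K = (\<lambda>x. 0 + (- 1) *\<^sub>R x) ` cart_power K"
  proof (intro set_eqI iffI)
    fix z :: "'a ^ 'p" assume "z \<in> (\<lambda>x. (- 1) *\<^sub>R diag x) ` K"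
    then show "z \<in> (\<lambda>x. 0 + (- 1) *\<^sub>R x) ` cart_power K" by (auto simp: cart_power_def diag_def)
  next
    fix z :: "'a ^ 'p" assume "z \<in> (\<lambda>x. 0 + (- 1) *\<^sub>R x) ` cart_power K"
    then obtain y where y: "z = 0 + (- 1) *\<^sub>R y" "y \<in> cart_power K" by blast
    have "y = diag (y $ i0)" using i0 by (auto simp: vec_eq_iff diag_def)
    then show "z \<in> (\<lambda>x. (- 1) *\<^sub>R diag x) ` K"
      using y by (intro image_eqI[of _ _ "y $ i0"]) (auto simp: cart_power_def)
  qed
  have "(\<lambda>y. (1 - 1) *\<^sub>R y) ` (cart_power K :: ('a ^ 'p) set) = {0}" using zero_cart_power by auto
  moreover have "(0 :: 'a ^ 'p) \<in> (\<lambda>x. 0 + (- 1) *\<^sub>R x) ` cart_power K"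
    using zero_cart_power by (intro image_eqI[of _ _ 0]) auto
  moreover have "convex ((\<lambda>x. 0 + (- 1) *\<^sub>R x) ` (cart_power K :: ('a ^ 'p) set))"
    by (intro convex_affinity convex_cart_power cvx)
  ultimately have "diag_join 1 K = (\<lambda>x. 0 + (- 1) *\<^sub>R x) ` (cart_power K :: ('a ^ 'p) set)"
    unfolding diag_join_def join_def eq by (simp only: Un_insert_right Un_empty_right insert_absorb hull_same[of convex])
  then have "emeasure lborel (diag_join 1 K :: ('a ^ 'p) set) = emeasure lborel K ^ CARD('p)"
    by (simp only: emeasure_lborel_affine[OF compact_cart_power[OF cpt]] emeasure_cart_power[OF cpt]) simp
  then show ?thesis
    using meas_diag_join[of 1, where 'p = 'p] True by (simp add: measure_def enn2real_power)
next
  case False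
  then have "\<not> (\<exists>i :: 'p. UNIV = {i})" by (auto simp: card_1_singleton_iff)
  then obtain i j :: 'p where ij: "i \<noteq> j" by (metis UNIV_I UNIV_eq_I singletonI)
  obtain e :: 'a where e: "e \<in> Basis" using nonempty_Basis by blast
  define a :: "'a ^ 'p" where "a = axis i e - axis j e"
  have "a $ i = e" using ij by (simp add: a_def axis_def)
  then have "a \<noteq> 0" using e by force
  have "diag_join 1 K \<subseteq> {z. a \<bullet> z = 0}"
    by (rule diag_join_subset_hyperplane) (auto simp: a_def inner_diff_left inner_axis' diag_def)
  then have "negligible (diag_join 1 K :: ('a ^ 'p) set)"
    using negligible_hyperplane[of a 0] \<open>a \<noteq> 0\<close> negligible_subset by blast
  then show ?thesis by (simp add: negligible_imp_measure0)
qed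

text \<open>A hyperplane containing \<open>K\<close> passes through 0; imposing it on one coordinate
  gives a hyperplane that contains the join.\<close>

lemma measure_diag_join_degenerate:
  assumes "interior K = {}"
  shows "measure lebesgue (diag_join t K :: ('a ^ 'p) set) = 0"
proof -
  obtain a b where ab: "a \<noteq> 0" "K \<subseteq> {x. a \<bullet> x = b}"
    using empty_interior_subset_hyperplane[OF cvx assms] by blast
  then have b: "b = 0" using zero by auto
  define c :: "'a ^ 'p" where "c = axis undefined a"
  have "c \<noteq> 0" using ab by (simp add: c_def axis_eq_0_iff)
  have "diag_join t K \<subseteq> {z. c \<bullet> z = 0}"
    using ab b by (intro diag_join_subset_hyperplane) (auto simp: c_def inner_axis' diag_def cart_power_def)
  then have "negligible (diag_join t K :: ('a ^ 'p) set)"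
    using negligible_hyperplane[of c 0] \<open>c \<noteq> 0\<close> negligible_subset by blast
  then show ?thesis by (simp add: negligible_imp_measure0)
qed

lemma emeasure_pos:
  assumes "interior K \<noteq> {}"
  shows "emeasure lborel K \<noteq> 0"
proof
  assume "emeasure lborel K = 0"
  then have "negligible K" by (simp add: negligible_iff_null_sets null_sets_completionI null_sets_def)
  then show False using assms negligible_convex_interior[OF cvx] by blast
qed

section \<open>Comparison of the two volume computations\<close>

lemma
  assumes t: "0 < t" "t < 1" and int: "interior K \<noteq> {}"
  shows measure_diag_join_le: "measure lebesgue (diag_join t K :: ('a ^ 'p) set)
      \<le> (1 - t) ^ (DIM('a) * (CARD('p) - 1)) * measure lebesgue K ^ CARD('p)" (is ?le)
    and split_body_if_measure_diag_join_eq: "measure lebesgue (diag_join t K :: ('a ^ 'p) set)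
      = (1 - t) ^ (DIM('a) * (CARD('p) - 1)) * measure lebesgue K ^ CARD('p) \<Longrightarrow> split_body K"
proof -
  let ?C = "join_lift t K :: (('a ^ 'p) \<times> 'a \<times> real) set"
  let ?M = "diag_join t K :: ('a ^ 'p) set"
  let ?n = "DIM('a)" and ?p = "CARD('p)"
  have t': "t \<in> {0..1}" using t by simp
  interpret F: fibred_body ?C by (rule fibred[OF t'])
  define k where "k = measure lebesgue K"
  define m where "m = measure lebesgue ?M"
  define b where "b = enn2real (beta_nat ?n (?p * ?n))"
  have ek: "emeasure lborel K = ennreal k"
    using emeasure_compact_finite[OF cpt] meas by (simp add: k_def emeasure_eq_ennreal_measure less_top)
  have em: "emeasure lborel ?M = ennreal m"
    using emeasure_compact_finite[OF compact_diag_join[of t, where 'p = 'p]] meas_diag_join[of t, where 'p = 'p]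
    by (simp add: m_def emeasure_eq_ennreal_measure less_top)
  have eb: "beta_nat ?n (?p * ?n) = ennreal b" using beta_nat_finite by (simp add: b_def less_top)
  have k: "0 < k" using emeasure_pos[OF int] ek by (simp add: ennreal_eq_0_iff not_le)
  have b: "0 < b" using beta_nat_pos[of ?n "?p * ?n"] eb by (simp add: ennreal_eq_0_iff not_le)
  have m: "0 \<le> m" by (simp add: m_def)
  have f0: "emeasure lborel (F.fibre 0) = ennreal ((1 - t) ^ ?n / (?n + 1) * k)"
  proof -
    have "F.fibre 0 = cone_fibre ((1 - t) / t) K 0"
      using join_lift_fibre[OF t(1), where 'p = 'p, of 0] by simp
    then have "emeasure lborel (F.fibre 0) = ennreal ((1 - t) ^ ?n / (?n + 1)) * ennreal k"
      by (simp only: emeasure_cone_fibre[OF t] ek)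
    also have "\<dots> = ennreal ((1 - t) ^ ?n / (?n + 1) * k)"
      using t by (intro ennreal_mult'[symmetric]) simp
    finally show ?thesis .
  qed
  \<comment> \<open>The fibre dimension \<open>?n + 1\<close> cancels the denominator in the volume
    of the double cone; both sides then share the positive factor
    \<open>(1 - t) ^ ?n * k * b\<close>.\<close>
  have lhs: "emeasure lborel (F.fibre 0) * (emeasure lborel F.base * (of_nat DIM('a \<times> real) * beta_nat (DIM('a \<times> real) - 1) DIM('a ^ 'p)))
      = ennreal (((1 - t) ^ ?n * k * b) * m)"
  proof -
    have "emeasure lborel (F.fibre 0) * (emeasure lborel F.base * (of_nat DIM('a \<times> real) * beta_nat (DIM('a \<times> real) - 1) DIM('a ^ 'p)))
      = ennreal ((1 - t) ^ ?n / (?n + 1) * k) * (ennreal m * (ennreal (?n + 1) * ennreal b))"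
      by (simp add: f0 fst_join_lift em eb ennreal_of_nat_eq_real_of_nat)
    also have "\<dots> = ennreal (((1 - t) ^ ?n / (?n + 1) * k) * (m * ((?n + 1) * b)))"
    proof -
      have *: "ennreal x * (ennreal m * (ennreal y * ennreal b)) = ennreal (x * (m * (y * b)))" if "0 \<le> x" "0 \<le> y" for x y
        using that m b by (simp add: ennreal_mult)
      show ?thesis by (rule *) (use t k in simp_all)
    qed
    also have "((1 - t) ^ ?n / (?n + 1) * k) * (m * ((?n + 1) * b)) = ((1 - t) ^ ?n * k * b) * m"
      by (simp add: field_simps)
    finally show ?thesis .
  qed
  \<comment> \<open>Separates the power of 1 - t that belongs to the fibre over 0; the subtraction
    is genuine because \<open>?p\<close> is positive.\<close>
  have "?p * ?n = ?n + ?n * (?p - 1)" by (cases ?p) (auto simp: algebra_simps)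
  then have rhs: "emeasure lborel ?C = ennreal (((1 - t) ^ ?n * k * b) * ((1 - t) ^ (?n * (?p - 1)) * k ^ ?p))"
    unfolding emeasure_join_lift[OF t'] ek eb using t k b
    by (simp add: ennreal_power ennreal_mult power_add mult_ac)
  have pos: "0 < (1 - t) ^ ?n * k * b" using t k b by simp
  show ?le
    using F.section_times_projection_le unfolding lhs rhs using pos t k b
    by (simp add: ennreal_le_iff k_def[symmetric] m_def[symmetric])
  assume "measure lebesgue ?M = (1 - t) ^ (?n * (?p - 1)) * measure lebesgue K ^ ?p"
  then have eq: "m = (1 - t) ^ (?n * (?p - 1)) * k ^ ?p" by (simp add: k_def m_def)
  have hom: "\<exists>g s. 0 < s \<and> F.fibre z = (\<lambda>v. g + s *\<^sub>R v) ` F.fibre 0" if "z \<in> interior ?M" for z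
  proof (rule F.fibres_homothetic_if_section_times_projection_eq)
    show "emeasure lborel (F.fibre 0) \<noteq> 0" using f0 t k by (simp add: ennreal_eq_0_iff not_le)
    show "z \<in> interior F.base" using that by (simp add: fst_join_lift)
  qed (simp only: lhs rhs eq order_refl)
  \<comment> \<open>Since 0 is interior to the join, so are all diagonal points near it, and
    homothety is available for a whole ball of \<open>y\<close>.\<close>
  have "open ((\<lambda>y. diag (t *\<^sub>R y) :: 'a ^ 'p) -` interior ?M)"
    by (intro open_vimage open_interior continuous_intros)
  moreover have "0 \<in> (\<lambda>y. diag (t *\<^sub>R y) :: 'a ^ 'p) -` interior ?M"
    using zero_in_interior_diag_join[OF t int] by simp
  ultimately obtain e where "0 < e" "\<forall>y. dist y 0 < e \<longrightarrow> y \<in> (\<lambda>y. diag (t *\<^sub>R y) :: 'a ^ 'p) -` interior ?M"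
    unfolding open_dist by blast
  then have e: "0 < e" "\<And>y. norm y < e \<Longrightarrow> (diag (t *\<^sub>R y) :: 'a ^ 'p) \<in> interior ?M" by auto
  show "split_body K"
  proof (rule split_body_if_fibres_homothetic[OF body zero _ e(1)])
    show "0 < (1 - t) / t" using t by simp
    show "\<exists>g s. 0 < s \<and> cone_fibre ((1 - t) / t) K y = (\<lambda>v. g + s *\<^sub>R v) ` cone_fibre ((1 - t) / t) K 0"
      if "norm y < e" for y
      using hom[OF e(2)[OF that]] join_lift_fibre[OF t(1), where 'p = 'p, of y] join_lift_fibre[OF t(1), where 'p = 'p, of 0]
      by simp
  qed
qed

end

theorem theorem1p9:
  fixes K :: "(real ^ 'n) set"
  assumes "CARD('n) \<ge> 2"
    and "convex_body K"
    and "0 \<in> K"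
  shows "(\<forall>t\<in>{0..1}.
            measure lebesgue
              ((\<lambda>x. (- t) *\<^sub>R (diag x :: real ^ 'n ^ 'p)) ` K
                 \<squnion>\<^sub>c (\<lambda>y. (1 - t) *\<^sub>R y) ` cart_power K)
            \<le> (1 - t) ^ (CARD('n) * (CARD('p) - 1)) * measure lebesgue K ^ CARD('p))
       \<and> (aff_dim K = int CARD('n) \<longrightarrow>
          (\<exists>t\<in>{0<..<1}.
            measure lebesgue
              ((\<lambda>x. (- t) *\<^sub>R (diag x :: real ^ 'n ^ 'p)) ` K
                 \<squnion>\<^sub>c (\<lambda>y. (1 - t) *\<^sub>R y) ` cart_power K)
            = (1 - t) ^ (CARD('n) * (CARD('p) - 1)) * measure lebesgue K ^ CARD('p)) \<longrightarrow>
          (\<exists>V. simplex_with_vertices K V \<and> 0 \<in> V))"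
proof -
  interpret body_at_zero K by standard (use assms in auto)
  show ?thesis unfolding diag_join_def[symmetric]
  proof (intro conjI ballI impI)
    fix t :: real assume t: "t \<in> {0..1}"
    show "measure lebesgue (diag_join t K :: (real ^ 'n ^ 'p) set)
        \<le> (1 - t) ^ (CARD('n) * (CARD('p) - 1)) * measure lebesgue K ^ CARD('p)"
    \<comment> \<open>Without interior \<open>K\<close> has volume 0 and the common factor cannot be
      cancelled, so this case is treated directly.\<close>
    proof (cases "interior K = {}")
      case True
      then show ?thesis using t by (simp add: measure_diag_join_degenerate)
    next
      case False
      consider "t = 0" | "t = 1" | "0 < t" "t < 1" using t by fastforce
      then show ?thesis
      proof cases
        case 1 then show ?thesis by (simp add: measure_diag_join_0)
      next
        case 2 then show ?thesis using measure_diag_join_1[where 'p = 'p] by simp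
      next
        case 3 then show ?thesis using measure_diag_join_le[OF 3 False, where 'p = 'p] by simp
      qed
    qed
  next
    assume dimK: "aff_dim K = int CARD('n)"
      and "\<exists>t\<in>{0<..<1}. measure lebesgue (diag_join t K :: (real ^ 'n ^ 'p) set)
        = (1 - t) ^ (CARD('n) * (CARD('p) - 1)) * measure lebesgue K ^ CARD('p)"
    then obtain t where t: "0 < t" "t < 1" and eq: "measure lebesgue (diag_join t K :: (real ^ 'n ^ 'p) set)
        = (1 - t) ^ (CARD('n) * (CARD('p) - 1)) * measure lebesgue K ^ CARD('p)" by auto
    have int: "interior K \<noteq> {}"
    proof
      assume "interior K = {}"
      then obtain a b where "a \<noteq> 0" "K \<subseteq> {x. a \<bullet> x = b}"
        using empty_interior_subset_hyperplane[OF cvx] by blast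
      then have "aff_dim K \<le> int (DIM(real ^ 'n) - 1)"
        using aff_dim_subset[of K "{x. a \<bullet> x = b}"] aff_dim_hyperplane[of a b] by simp
      then show False using dimK by (simp add: of_nat_diff)
    qed
    interpret split_body K
      using split_body_if_measure_diag_join_eq[OF t int, where 'p = 'p] eq by simp
    show "\<exists>V. simplex_with_vertices K V \<and> 0 \<in> V"
      using simplex zero_extreme by blast
  qed
qed

end
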